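(* Let $\mathbb X$ be a virtual equipment and let $j\colon A\to E$ and $r\colon C\to E$ be tight-cells. A tight-cell $\ell\colon A\to C$ is left $j$-adjoint to $r$ (i.e. there is a relative adjunction $\ell\dashv_j r$) if and only if there is a 2-cell $\eta\colon j\Rightarrow r\ell$ exhibiting $\ell$ as the (pointwise) left lift of $j$ through $r$.
   Context: Virtual equipments. A virtual double category has objects; a category of tight-cells $f\colon A\to B$ (the composite of $f\colon A\to B$ and $g\colon B\to C$ is $gf$); loose-cells $p\colon A\nrightarrow B$; and 2-cells, each having as frame a chain of loose-cells $p_1\colon A_1\nrightarrow A_0,\dots,p_n\colon A_n\nrightarrow A_{n-1}$ ($n\ge 0$; chains are always listed in this order), a loose-cell $q\colon B_n\nrightarrow B_0$, and tight-cells $f_0\colon A_0\to B_0$ (left) and $f_n\colon A_n\to B_n$ (right); 2-cells have identities and associative unital multicategory-style composition. $\phi\colon p_1,\dots,p_n\Rightarrow q$ denotes a 2-cell whose tight-cells are identities; $(\phi_1,\dots,\phi_n)$ denotes juxtaposition. A 2-cell $q_1,\dots,q_m\Rightarrow q$ is opcartesian if every 2-cell (with any tight-cells) with domain $p_1,\dots,p_l,q_1,\dots,q_m,r_1,\dots,r_n$ factors uniquely through it; then $q$ is the loose-composite $q_1\odot\cdots\odot q_m$ (the loose-identity $A(1,1)\colon A\nrightarrow A$ if $m=0$). A unary 2-cell from $p$ to $q$ with left $f$ and right $g$ is cartesian if every 2-cell into $q$ with left $ff'$ and right $gg'$ factors uniquely through it via a 2-cell with left $f'$ and right $g'$; then $p$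 is the restriction $q(f,g)$. A virtual equipment has all loose-identities and restrictions. Write $E(f,g):=E(1,1)(f,g)$; for $f\colon D\to E$, $g\colon A\to E$ it is a loose-cell $A\nrightarrow D$. The canonical isomorphisms $q(f,g)\cong C(f,1)\odot q\odot B(1,g)$ are used implicitly. A 2-cell $f\Rightarrow g$ between tight-cells $A\to B$ is equivalently a 2-cell $B(1,f)\Rightarrow B(1,g)$, or $B(g,1)\Rightarrow B(f,1)$, or $()\Rightarrow B(f,g)$. Restriction is functorial in 2-cells (contravariantly in the first argument, covariantly in the second). Relative adjunction. $\ell\dashv_j r$ consists of tight-cells $j\colon A\to E$, $\ell\colon A\to C$, $r\colon C\to E$ and an isomorphism $C(\ell,1)\cong E(j,r)$ of loose-cells $C\nrightarrow A$. Right extension. For $p\colon X\nrightarrow Y$ and $q\colon X\nrightarrow Z$, a right extension of $q$ along $p$ is a loose-cell $s\colon Y\nrightarrow Z$ with a 2-cell $\varpi\colon s,p\Rightarrow q$ such that every 2-cell $r_1,\dots,r_n,p\Rightarrow q$ ($n\ge0$) factors uniquely as $\varpi\circ(\psi,1_p)$ with $\psi\colon r_1,\dots,r_n\Rightarrow s$. Left lift. For tight-cells $j\colon A\to E$ and $r\colon C\to E$, a tight-cell $\ell\colon A\to C$ with a 2-cell $\eta\colon j\Rightarrow r\ell$ is the (pointwise) left lift of $j$ through $r$ when the 2-cell $C(\ell,1),E(r,1)\Rightarrow E(r\ell,1)\Rightarrow E(j,1)$ (the opcartesian 2-cell followed by $E(\eta,1)$) exhibits $C(\ell,1)$ as the right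 extension of $E(j,1)$ along $E(r,1)$. *)

theory Defs
  imports Main
begin

text \<open>
  A loose-cell \<open>p\<close> from \<open>A\<close> to \<open>B\<close> has \<open>lsrc p = A\<close> and \<open>ltgt p = B\<close>. A 2-cell \<open>\<phi>\<close> with frame
  \<open>p\<^sub>1, \<dots>, p\<^sub>n\<close> over \<open>q\<close> has \<open>ctop \<phi> = [p\<^sub>1, \<dots>, p\<^sub>n]\<close> and \<open>cbot \<phi> = q\<close>; since
  \<open>p\<^sub>1\<close> goes from \<open>A\<^sub>1\<close> to \<open>A\<^sub>0\<close>, the left boundary is on the \<^emph>\<open>target\<close> side of the loose-cells.

  \<open>ccomp \<phi> f [\<phi>\<^sub>1, \<dots>, \<phi>\<^sub>m]\<close> is the composite of \<open>\<phi>\<close> with the juxtaposition of \<open>\<phi>\<^sub>1, \<dots>, \<phi>\<^sub>m\<close>, whose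
  left tight-cell is \<open>f\<close>. The argument \<open>f\<close> is redundant unless \<open>m = 0\<close>, when it is the tight-cell
  along which the nullary 2-cell \<open>\<phi>\<close> is precomposed.
\<close>

record ('o, 't, 'l, 'c) vdc =
  Obj :: "'o set"
  Tight :: "'t set"
  Loose :: "'l set"
  Cell :: "'c set"
  tdom :: "'t \<Rightarrow> 'o"
  tcod :: "'t \<Rightarrow> 'o"
  tid :: "'o \<Rightarrow> 't"
  tcomp :: "'t \<Rightarrow> 't \<Rightarrow> 't"  (infixl "\<cdot>\<index>" 70)
  lsrc :: "'l \<Rightarrow> 'o"
  ltgt :: "'l \<Rightarrow> 'o"
  ctop :: "'c \<Rightarrow> 'l list"
  cbot :: "'c \<Rightarrow> 'l"
  cleft :: "'c \<Rightarrow> 't"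
  cright :: "'c \<Rightarrow> 't"
  cid :: "'l \<Rightarrow> 'c"
  ccomp :: "'c \<Rightarrow> 't \<Rightarrow> 'c list \<Rightarrow> 'c"

definition tight_in :: "('o, 't, 'l, 'c) vdc \<Rightarrow> 't \<Rightarrow> 'o \<Rightarrow> 'o \<Rightarrow> bool" where
  "tight_in X f A B \<longleftrightarrow> f \<in> Tight X \<and> tdom X f = A \<and> tcod X f = B"

definition cell_in ::
  "('o, 't, 'l, 'c) vdc \<Rightarrow> 'c \<Rightarrow> 'l list \<Rightarrow> 'l \<Rightarrow> 't \<Rightarrow> 't \<Rightarrow> bool" where
  "cell_in X \<phi> ps q f g \<longleftrightarrow>
     \<phi> \<in> Cell X \<and> ctop X \<phi> = ps \<and> cbot X \<phi> = q \<and> cleft X \<phi> = f \<and> cright X \<phi> = g"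

text \<open>Chains of loose-cells, with leftmost object \<open>L\<close> and rightmost object \<open>R\<close>.\<close>

fun loose_chain :: "('o, 't, 'l, 'c) vdc \<Rightarrow> 'o \<Rightarrow> 'l list \<Rightarrow> 'o \<Rightarrow> bool" where
  "loose_chain X L [] R \<longleftrightarrow> L \<in> Obj X \<and> L = R"
| "loose_chain X L (p # ps) R \<longleftrightarrow> p \<in> Loose X \<and> ltgt X p = L \<and> loose_chain X (lsrc X p) ps R"

text \<open>Juxtaposable chains of 2-cells, with leftmost tight-cell \<open>f\<close> and rightmost tight-cell \<open>g\<close>.\<close>

fun cell_chain :: "('o, 't, 'l, 'c) vdc \<Rightarrow> 't \<Rightarrow> 'c list \<Rightarrow> 't \<Rightarrow> bool" where
  "cell_chain X f [] g \<longleftrightarrow> f \<in> Tight X \<and> f = g"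
| "cell_chain X f (\<phi> # \<phi>s) g \<longleftrightarrow> \<phi> \<in> Cell X \<and> cleft X \<phi> = f \<and> cell_chain X (cright X \<phi>) \<phi>s g"

definition composable :: "('o, 't, 'l, 'c) vdc \<Rightarrow> 'c \<Rightarrow> 't \<Rightarrow> 'c list \<Rightarrow> 't \<Rightarrow> bool" where
  "composable X \<phi> f \<phi>s g \<longleftrightarrow>
     \<phi> \<in> Cell X \<and> cell_chain X f \<phi>s g \<and> map (cbot X) \<phi>s = ctop X \<phi> \<and> tcod X f = tdom X (cleft X \<phi>)"

text \<open>
  \<open>comps X h [\<phi>\<^sub>1, \<dots>, \<phi>\<^sub>m] [\<psi>s\<^sub>1, \<dots>, \<psi>s\<^sub>m]\<close> is the chain of the composites of \<open>\<phi>\<^sub>i\<close> with \<open>\<psi>s\<^sub>i\<close>, where the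
  concatenation of the chains \<open>\<psi>s\<^sub>i\<close> has leftmost tight-cell \<open>h\<close>.
\<close>

fun comps :: "('o, 't, 'l, 'c) vdc \<Rightarrow> 't \<Rightarrow> 'c list \<Rightarrow> 'c list list \<Rightarrow> 'c list" where
  "comps X h (\<phi> # \<phi>s) (\<psi>s # \<psi>ss) =
     ccomp X \<phi> h \<psi>s # comps X (if \<psi>s = [] then h else cright X (last \<psi>s)) \<phi>s \<psi>ss"
| "comps X h _ _ = []"

locale virtual_double_category =
  fixes X :: "('o, 't, 'l, 'c) vdc" (structure)
  assumes tdom_Obj: "f \<in> Tight X \<Longrightarrow> tdom X f \<in> Obj X"
    and tcod_Obj: "f \<in> Tight X \<Longrightarrow> tcod X f \<in> Obj X"
    and tid_in: "A \<in> Obj X \<Longrightarrow> tight_in X (tid X A) A A"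
    and tcomp_in: "tight_in X f A B \<Longrightarrow> tight_in X g B C \<Longrightarrow> tight_in X (g \<cdot> f) A C"
    and tcomp_assoc: "tight_in X f A B \<Longrightarrow> tight_in X g B C \<Longrightarrow> tight_in X h C D
      \<Longrightarrow> (h \<cdot> g) \<cdot> f = h \<cdot> (g \<cdot> f)"
    and tcomp_id_left: "tight_in X f A B \<Longrightarrow> tid X B \<cdot> f = f"
    and tcomp_id_right: "tight_in X f A B \<Longrightarrow> f \<cdot> tid X A = f"
    and lsrc_Obj: "p \<in> Loose X \<Longrightarrow> lsrc X p \<in> Obj X"
    and ltgt_Obj: "p \<in> Loose X \<Longrightarrow> ltgt X p \<in> Obj X"
    and left_in: "\<phi> \<in> Cell X \<Longrightarrow> cleft X \<phi> \<in> Tight X"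
    and right_in: "\<phi> \<in> Cell X \<Longrightarrow> cright X \<phi> \<in> Tight X"
    and top_chain: "\<phi> \<in> Cell X
      \<Longrightarrow> loose_chain X (tdom X (cleft X \<phi>)) (ctop X \<phi>) (tdom X (cright X \<phi>))"
    and bot_in: "\<phi> \<in> Cell X \<Longrightarrow> cbot X \<phi> \<in> Loose X"
    and bot_tgt: "\<phi> \<in> Cell X \<Longrightarrow> ltgt X (cbot X \<phi>) = tcod X (cleft X \<phi>)"
    and bot_src: "\<phi> \<in> Cell X \<Longrightarrow> lsrc X (cbot X \<phi>) = tcod X (cright X \<phi>)"
    and cid_in: "p \<in> Loose X
      \<Longrightarrow> cell_in X (cid X p) [p] p (tid X (ltgt X p)) (tid X (lsrc X p))"
    and comp_in: "composable X \<phi> f \<phi>s g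
      \<Longrightarrow> cell_in X (ccomp X \<phi> f \<phi>s) (concat (map (ctop X) \<phi>s)) (cbot X \<phi>)
            (cleft X \<phi> \<cdot> f) (cright X \<phi> \<cdot> g)"
    and comp_id_left: "\<phi> \<in> Cell X \<Longrightarrow> ccomp X (cid X (cbot X \<phi>)) (cleft X \<phi>) [\<phi>] = \<phi>"
    and comp_id_right: "\<phi> \<in> Cell X
      \<Longrightarrow> ccomp X \<phi> (tid X (tdom X (cleft X \<phi>))) (map (cid X) (ctop X \<phi>)) = \<phi>"
    and comp_assoc: "composable X \<phi> f \<phi>s g \<Longrightarrow> cell_chain X h (concat \<psi>ss) k
      \<Longrightarrow> map (map (cbot X)) \<psi>ss = map (ctop X) \<phi>s \<Longrightarrow> tcod X h = tdom X f
      \<Longrightarrow> ccomp X \<phi> (f \<cdot> h) (comps X h \<phi>s \<psi>ss) = ccomp X (ccomp X \<phi> f \<phi>s) h (concat \<psi>ss)"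

text \<open>\<open>globular X \<phi> ps q\<close> renders \<open>\<phi>: ps \<Rightarrow> q\<close>, a 2-cell whose tight-cells are identities.\<close>

definition globular :: "('o, 't, 'l, 'c) vdc \<Rightarrow> 'c \<Rightarrow> 'l list \<Rightarrow> 'l \<Rightarrow> bool" where
  "globular X \<phi> ps q \<longleftrightarrow> cell_in X \<phi> ps q (tid X (ltgt X q)) (tid X (lsrc X q))"

definition loose_iso :: "('o, 't, 'l, 'c) vdc \<Rightarrow> 'c \<Rightarrow> 'l \<Rightarrow> 'l \<Rightarrow> bool" where
  "loose_iso X \<phi> p q \<longleftrightarrow> globular X \<phi> [p] q \<and>
     (\<exists>\<psi>. globular X \<psi> [q] p \<and>
        ccomp X \<psi> (tid X (ltgt X p)) [\<phi>] = cid X p \<and>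
        ccomp X \<phi> (tid X (ltgt X q)) [\<psi>] = cid X q)"

text \<open>
  When \<open>\<phi>\<close> is nullary, the chain condition says that the object at which \<open>q\<close> is inserted between
  \<open>ps\<close> and \<open>rs\<close> is the right one; otherwise it is automatic.
\<close>

definition opcartesian :: "('o, 't, 'l, 'c) vdc \<Rightarrow> 'c \<Rightarrow> 'l list \<Rightarrow> 'l \<Rightarrow> bool" where
  "opcartesian X \<phi> qs q \<longleftrightarrow> globular X \<phi> qs q \<and>
     (\<forall>ps rs \<psi>. \<psi> \<in> Cell X \<longrightarrow> ctop X \<psi> = ps @ qs @ rs \<longrightarrow>
        loose_chain X (tdom X (cleft X \<psi>)) (ps @ [q] @ rs) (tdom X (cright X \<psi>)) \<longrightarrow>
        (\<exists>!\<chi>. cell_in X \<chi> (ps @ [q] @ rs) (cbot X \<psi>) (cleft X \<psi>) (cright X \<psi>) \<and>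
           ccomp X \<chi> (tid X (tdom X (cleft X \<psi>))) (map (cid X) ps @ [\<phi>] @ map (cid X) rs) = \<psi>))"

definition loose_identity :: "('o, 't, 'l, 'c) vdc \<Rightarrow> 'c \<Rightarrow> 'o \<Rightarrow> bool" where
  "loose_identity X \<phi> A \<longleftrightarrow> opcartesian X \<phi> [] (cbot X \<phi>) \<and>
     ltgt X (cbot X \<phi>) = A \<and> lsrc X (cbot X \<phi>) = A"

definition cartesian ::
  "('o, 't, 'l, 'c) vdc \<Rightarrow> 'c \<Rightarrow> 'l \<Rightarrow> 'l \<Rightarrow> 't \<Rightarrow> 't \<Rightarrow> bool" where
  "cartesian X \<phi> p q f g \<longleftrightarrow> cell_in X \<phi> [p] q f g \<and>
     (\<forall>\<psi> f' g'. f' \<in> Tight X \<longrightarrow> g' \<in> Tight X \<longrightarrow>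
        tcod X f' = tdom X f \<longrightarrow> tcod X g' = tdom X g \<longrightarrow>
        \<psi> \<in> Cell X \<longrightarrow> cbot X \<psi> = q \<longrightarrow>
        cleft X \<psi> = f \<cdot>\<^bsub>X\<^esub> f' \<longrightarrow> cright X \<psi> = g \<cdot>\<^bsub>X\<^esub> g' \<longrightarrow>
        (\<exists>!\<chi>. cell_in X \<chi> (ctop X \<psi>) p f' g' \<and> ccomp X \<phi> f' [\<chi>] = \<psi>))"

locale virtual_equipment = virtual_double_category +
  assumes ex_loose_identity: "A \<in> Obj X \<Longrightarrow> \<exists>\<phi>. loose_identity X \<phi> A"
    and ex_restriction: "q \<in> Loose X \<Longrightarrow> f \<in> Tight X \<Longrightarrow> g \<in> Tight X
      \<Longrightarrow> tcod X f = ltgt X q \<Longrightarrow> tcod X g = lsrc X q \<Longrightarrow> \<exists>\<phi> p. cartesian X \<phi> p q f g"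

text \<open>
  Loose-identities and restrictions are unique up to isomorphism; as usual we work with an
  arbitrary choice of them, together with their universal 2-cells. Below, \<open>lid X A\<close> is \<open>A(1,1)\<close>,
  \<open>restr X q f g\<close> is \<open>q(f,g)\<close>, and \<open>hom X f g\<close> is \<open>E(f,g)\<close> for \<open>E\<close> the common codomain of \<open>f\<close> and \<open>g\<close>.
\<close>

definition lid_cell :: "('o, 't, 'l, 'c) vdc \<Rightarrow> 'o \<Rightarrow> 'c" where
  "lid_cell X A = (SOME \<phi>. loose_identity X \<phi> A)"

definition lid :: "('o, 't, 'l, 'c) vdc \<Rightarrow> 'o \<Rightarrow> 'l" where
  "lid X A = cbot X (lid_cell X A)"

definition cart_cell :: "('o, 't, 'l, 'c) vdc \<Rightarrow> 'l \<Rightarrow> 't \<Rightarrow> 't \<Rightarrow> 'c" where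
  "cart_cell X q f g = (SOME \<phi>. \<exists>p. cartesian X \<phi> p q f g)"

definition restr :: "('o, 't, 'l, 'c) vdc \<Rightarrow> 'l \<Rightarrow> 't \<Rightarrow> 't \<Rightarrow> 'l" where
  "restr X q f g = hd (ctop X (cart_cell X q f g))"

definition hom :: "('o, 't, 'l, 'c) vdc \<Rightarrow> 't \<Rightarrow> 't \<Rightarrow> 'l" where
  "hom X f g = restr X (lid X (tcod X f)) f g"

abbreviation hom_cart :: "('o, 't, 'l, 'c) vdc \<Rightarrow> 't \<Rightarrow> 't \<Rightarrow> 'c" where
  "hom_cart X f g \<equiv> cart_cell X (lid X (tcod X f)) f g"

text \<open>The canonical 2-cell \<open>B(1,1), q \<Rightarrow> q\<close>, for \<open>B\<close> the target of \<open>q\<close>.\<close>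

definition left_unitor :: "('o, 't, 'l, 'c) vdc \<Rightarrow> 'l \<Rightarrow> 'c" where
  "left_unitor X q = (THE \<kappa>. globular X \<kappa> [lid X (ltgt X q), q] q \<and>
     ccomp X \<kappa> (tid X (ltgt X q)) [lid_cell X (ltgt X q), cid X q] = cid X q)"

text \<open>A 2-cell \<open>\<eta>: f \<Rightarrow> g\<close> between tight-cells into \<open>B\<close> is a 2-cell \<open>() \<Rightarrow> B(f,g)\<close>.\<close>

definition tight_2cell :: "('o, 't, 'l, 'c) vdc \<Rightarrow> 'c \<Rightarrow> 't \<Rightarrow> 't \<Rightarrow> bool" where
  "tight_2cell X \<eta> f g \<longleftrightarrow> f \<in> Tight X \<and> g \<in> Tight X \<and>
     tdom X f = tdom X g \<and> tcod X f = tcod X g \<and> globular X \<eta> [] (hom X f g)"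

text \<open>
  Contravariant functoriality of restriction in the first argument: for \<open>\<eta>: f \<Rightarrow> f'\<close> between
  tight-cells into \<open>B\<close>, the 2-cell \<open>q(\<eta>,g): q(f',g) \<Rightarrow> q(f,g)\<close> is the factorisation through
  the cartesian 2-cell of \<open>q(f,g)\<close> of the composite of
  \<open>() \<Rightarrow> B(f,f') \<rightarrow> B(1,1)\<close> and \<open>q(f',g) \<rightarrow> q\<close> with \<open>B(1,1), q \<Rightarrow> q\<close>.
\<close>

definition restr_2cell :: "('o, 't, 'l, 'c) vdc \<Rightarrow> 'l \<Rightarrow> 'c \<Rightarrow> 't \<Rightarrow> 't \<Rightarrow> 't \<Rightarrow> 'c" where
  "restr_2cell X q \<eta> f f' g = (THE \<kappa>. globular X \<kappa> [restr X q f' g] (restr X q f g) \<and>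
     ccomp X (cart_cell X q f g) (tid X (tdom X f)) [\<kappa>] =
     ccomp X (left_unitor X q) f
       [ccomp X (hom_cart X f f') (tid X (tdom X f)) [\<eta>], cart_cell X q f' g])"

text \<open>
  The canonical opcartesian 2-cell \<open>C(\<ell>,1), E(r,1) \<Rightarrow> E(r\<ell>,1)\<close>: the factorisation through the
  cartesian 2-cell of \<open>E(r\<ell>,1)\<close> of the composite
  \<open>C(\<ell>,1), E(r,1) \<rightarrow> C(1,1), E(r,1) \<Rightarrow> E(r,1) \<rightarrow> E(1,1)\<close>.
\<close>

definition hom_opcart :: "('o, 't, 'l, 'c) vdc \<Rightarrow> 't \<Rightarrow> 't \<Rightarrow> 'c" where
  "hom_opcart X l r = (let C = tcod X l; E = tcod X r; rl = r \<cdot>\<^bsub>X\<^esub> l in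
     (THE \<chi>. globular X \<chi> [hom X l (tid X C), hom X r (tid X E)] (hom X rl (tid X E)) \<and>
        ccomp X (hom_cart X rl (tid X E)) (tid X (tdom X l)) [\<chi>] =
        ccomp X (hom_cart X r (tid X E)) l
          [ccomp X (left_unitor X (hom X r (tid X E))) l
             [hom_cart X l (tid X C), cid X (hom X r (tid X E))]]))"

definition relative_adjunction ::
  "('o, 't, 'l, 'c) vdc \<Rightarrow> 't \<Rightarrow> 't \<Rightarrow> 't \<Rightarrow> 'c \<Rightarrow> bool" where
  "relative_adjunction X j l r \<phi> \<longleftrightarrow>
     (\<exists>A C E. tight_in X j A E \<and> tight_in X l A C \<and> tight_in X r C E \<and>
        loose_iso X \<phi> (hom X l (tid X C)) (hom X j r))"

text \<open>\<open>right_extension X s \<omega> q p\<close>: \<open>s\<close> and \<open>\<omega>: s, p \<Rightarrow> q\<close> form a right extension of \<open>q\<close> along \<open>p\<close>.\<close>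

definition right_extension ::
  "('o, 't, 'l, 'c) vdc \<Rightarrow> 'l \<Rightarrow> 'c \<Rightarrow> 'l \<Rightarrow> 'l \<Rightarrow> bool" where
  "right_extension X s \<omega> q p \<longleftrightarrow> globular X \<omega> [s, p] q \<and>
     (\<forall>rs \<phi>. globular X \<phi> (rs @ [p]) q \<longrightarrow>
        (\<exists>!\<psi>. globular X \<psi> rs s \<and> ccomp X \<omega> (tid X (ltgt X q)) [\<psi>, cid X p] = \<phi>))"

definition left_lift :: "('o, 't, 'l, 'c) vdc \<Rightarrow> 't \<Rightarrow> 't \<Rightarrow> 't \<Rightarrow> 'c \<Rightarrow> bool" where
  "left_lift X j r l \<eta> \<longleftrightarrow>
     (\<exists>A C E. tight_in X j A E \<and> tight_in X r C E \<and> tight_in X l A C \<and>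
        tight_2cell X \<eta> j (r \<cdot>\<^bsub>X\<^esub> l) \<and>
        right_extension X (hom X l (tid X C))
          (ccomp X (restr_2cell X (lid X E) \<eta> j (r \<cdot>\<^bsub>X\<^esub> l) (tid X E)) (tid X A) [hom_opcart X l r])
          (hom X j (tid X E)) (hom X r (tid X E)))"

end

theory Submission
  imports Defs
begin

text \<open>
  The conjoint \<open>E(r,1)\<close> carries a unit \<open>() \<Rightarrow> E(r,1)\<close> (left tight-cell \<open>1\<close>, right tight-cell \<open>r\<close>) and
  a counit \<open>E(r,1) \<rightarrow> E(1,1)\<close>, its cartesian 2-cell. The triangle identities turn 2-cells
  \<open>rs, E(r,1) \<Rightarrow> E(j,1)\<close> into 2-cells \<open>rs \<Rightarrow> E(j,r)\<close>, so \<open>E(j,r)\<close> is the right extension of \<open>E(j,1)\<close>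
  along \<open>E(r,1)\<close>. Hence a 2-cell \<open>C(l,1), E(r,1) \<Rightarrow> E(j,1)\<close> is a right extension if and only if the
  corresponding \<open>\<phi>: C(l,1) \<Rightarrow> E(j,r)\<close> is invertible. By the Yoneda lemma every such \<open>\<phi>\<close> arises from a
  unique \<open>\<eta>: j \<Rightarrow> rl\<close>; only existence is needed.
\<close>

subsection \<open>Composition of 2-cells\<close>

text \<open>The frame of a juxtaposition, as \<open>cell_in\<close> gives that of a single 2-cell.
  For an empty chain it forces \<open>f = g\<close>.\<close>

definition cells_in ::
  "('o, 't, 'l, 'c) vdc \<Rightarrow> 'c list \<Rightarrow> 'l list \<Rightarrow> 'l list \<Rightarrow> 't \<Rightarrow> 't \<Rightarrow> bool" where
  "cells_in X \<phi>s ps qs f g \<longleftrightarrow>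
     cell_chain X f \<phi>s g \<and> concat (map (ctop X) \<phi>s) = ps \<and> map (cbot X) \<phi>s = qs"

context virtual_double_category
begin

lemma tid_simps [simp]:
  assumes "A \<in> Obj X"
  shows "tid X A \<in> Tight X" "tdom X (tid X A) = A" "tcod X (tid X A) = A"
  using tid_in[OF assms] by (auto simp: tight_in_def)

lemma tcomp_simps [simp]:
  assumes "f \<in> Tight X" "g \<in> Tight X" "tcod X f = tdom X g"
  shows "g \<cdot> f \<in> Tight X" "tdom X (g \<cdot> f) = tdom X f" "tcod X (g \<cdot> f) = tcod X g"
  using tcomp_in[of f "tdom X f" "tcod X f" g "tcod X g"] assms by (auto simp: tight_in_def)

lemma tcomp_tid_simps [simp]:
  "f \<in> Tight X \<Longrightarrow> tcod X f = B \<Longrightarrow> tid X B \<cdot> f = f"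
  "f \<in> Tight X \<Longrightarrow> tdom X f = A \<Longrightarrow> f \<cdot> tid X A = f"
  by (auto intro: tcomp_id_left tcomp_id_right simp: tight_in_def)

lemma cell_inD:
  assumes "cell_in X \<phi> ps q f g"
  shows "\<phi> \<in> Cell X" "ctop X \<phi> = ps" "cbot X \<phi> = q" "cleft X \<phi> = f" "cright X \<phi> = g"
    "f \<in> Tight X" "g \<in> Tight X" "q \<in> Loose X" "ltgt X q = tcod X f" "lsrc X q = tcod X g"
    "loose_chain X (tdom X f) ps (tdom X g)"
  using assms left_in right_in bot_in bot_tgt bot_src top_chain by (auto simp: cell_in_def)

lemma cid_cell_in:
  "p \<in> Loose X \<Longrightarrow> ltgt X p = A \<Longrightarrow> lsrc X p = B \<Longrightarrow> cell_in X (cid X p) [p] p (tid X A) (tid X B)"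
  using cid_in by auto

lemma loose_chain_Obj: "loose_chain X L ps R \<Longrightarrow> L \<in> Obj X \<and> R \<in> Obj X"
  by (induction ps arbitrary: L) (auto simp: ltgt_Obj)

lemma loose_chain_append:
  "loose_chain X L (ps @ qs) R \<longleftrightarrow> (\<exists>M. loose_chain X L ps M \<and> loose_chain X M qs R)"
  by (induction ps arbitrary: L) (auto dest: loose_chain_Obj)

section \<open>Frames of juxtaposed 2-cells\<close>

lemma cells_in_Nil: "f \<in> Tight X \<Longrightarrow> cells_in X [] [] [] f f"
  by (simp add: cells_in_def)

lemma cells_in_Cons:
  "cell_in X \<phi> ps q f m \<Longrightarrow> cells_in X \<phi>s ps' qs m g \<Longrightarrow> cells_in X (\<phi> # \<phi>s) (ps @ ps') (q # qs) f g"
  by (auto simp: cells_in_def cell_in_def)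

lemma cells_in_single: "cell_in X \<phi> ps q f g \<Longrightarrow> cells_in X [\<phi>] ps [q] f g"
  using cells_in_Cons[OF _ cells_in_Nil, of \<phi> ps q f g] cell_inD(7)[of \<phi> ps q f g] by simp

lemma cells_in_pair:
  "cell_in X \<phi> ps q f m \<Longrightarrow> cell_in X \<psi> ps' q' m g \<Longrightarrow> cells_in X [\<phi>, \<psi>] (ps @ ps') [q, q'] f g"
  by (intro cells_in_Cons cells_in_single)

lemma cells_in_append:
  "cells_in X \<phi>s ps qs f m \<Longrightarrow> cells_in X \<psi>s ps' qs' m g
    \<Longrightarrow> cells_in X (\<phi>s @ \<psi>s) (ps @ ps') (qs @ qs') f g"
  by (induction \<phi>s arbitrary: f ps qs) (auto simp: cells_in_def)

lemma cells_in_ids: "loose_chain X L ps R \<Longrightarrow> cells_in X (map (cid X) ps) ps ps (tid X L) (tid X R)"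
proof (induction ps arbitrary: L)
  case Nil
  then show ?case by (auto intro: cells_in_Nil)
next
  case (Cons p ps)
  then have "cells_in X (cid X p # map (cid X) ps) ([p] @ ps) (p # ps) (tid X L) (tid X R)"
    by (intro cells_in_Cons[where m = "tid X (lsrc X p)"]) (auto intro: cid_cell_in)
  then show ?case by simp
qed

text \<open>The conditional is the expression by which \<open>comps\<close> hands the boundary
  tight-cell to the next block; applying \<open>comp_assoc\<close> requires matching it with the
  declared boundary \<open>g\<close>.\<close>

lemma cells_in_last:
  "cells_in X \<phi>s ps qs f g \<Longrightarrow> (if \<phi>s = [] then f else cright X (last \<phi>s)) = g"
proof -
  have "cell_chain X f \<phi>s g \<Longrightarrow> (if \<phi>s = [] then f else cright X (last \<phi>s)) = g"
    by (induction \<phi>s arbitrary: f) auto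
  then show "cells_in X \<phi>s ps qs f g \<Longrightarrow> ?thesis"
    by (simp add: cells_in_def)
qed

text \<open>The boundaries \<open>f'\<close> and \<open>g'\<close> enter through equations so that
  the rule also applies after composites with identities have been simplified.\<close>

lemma comp_cell_in:
  assumes "cell_in X \<phi> qs q f g" "cells_in X \<phi>s ps qs h k" "tcod X h = tdom X f"
    and "f' = f \<cdot> h" "g' = g \<cdot> k"
  shows "cell_in X (ccomp X \<phi> h \<phi>s) ps q f' g'"
  using comp_in[of \<phi> h \<phi>s k] assms by (auto simp: composable_def cell_in_def cells_in_def)

lemma comp1_cell_in:
  assumes "cell_in X \<phi> [q] r f g" "cell_in X \<psi> ps q h k" "f' = f \<cdot> h" "g' = g \<cdot> k"
  shows "cell_in X (ccomp X \<phi> h [\<psi>]) ps r f' g'"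
  using cell_inD(9,11)[OF assms(1)] cell_inD(9,11)[OF assms(2)]
  by (intro comp_cell_in[OF assms(1) cells_in_single[OF assms(2)] _ assms(3,4)]) auto

lemma comp2_cell_in:
  assumes "cell_in X \<phi> [q1, q2] r f g" "cell_in X \<psi>1 ps1 q1 h m" "cell_in X \<psi>2 ps2 q2 m k"
    and "ps = ps1 @ ps2" "f' = f \<cdot> h" "g' = g \<cdot> k"
  shows "cell_in X (ccomp X \<phi> h [\<psi>1, \<psi>2]) ps r f' g'"
  using cell_inD(9,11)[OF assms(1)] cell_inD(9,11)[OF assms(2)] unfolding assms(4)
  by (intro comp_cell_in[OF assms(1) cells_in_pair[OF assms(2,3)] _ assms(5,6)]) auto

section \<open>Special cases of associativity\<close>

lemma assoc1:
  assumes "cell_in X \<phi> [q] r f g" "cell_in X \<psi> qs q h k"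
    and "cells_in X \<chi>s ps qs h' k'" "tcod X h' = tdom X h" "h'' = h \<cdot> h'"
  shows "ccomp X \<phi> h'' [ccomp X \<psi> h' \<chi>s] = ccomp X (ccomp X \<phi> h [\<psi>]) h' \<chi>s"
proof -
  have "composable X \<phi> h [\<psi>] k"
    using assms(1,2) cell_inD(9,11)[OF assms(1)] cell_inD[OF assms(2)]
    by (auto simp: composable_def cell_in_def)
  then show ?thesis
    using comp_assoc[of \<phi> h "[\<psi>]" k h' "[\<chi>s]" k'] assms(2-)
    by (auto simp: cells_in_def cell_in_def)
qed

text \<open>Interchange for two middle 2-cells. The tight-cell \<open>m'\<close> between the blocks
  is explicit because an empty second block does not determine it.\<close>

lemma assoc2:
  assumes "cell_in X \<phi> [q1, q2] r f g" "cell_in X \<psi>1 qs1 q1 h m" "cell_in X \<psi>2 qs2 q2 m k"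
    and "cells_in X \<chi>s1 ps1 qs1 h' m'" "cells_in X \<chi>s2 ps2 qs2 m' k'"
    and "tcod X h' = tdom X h" "h'' = h \<cdot> h'"
  shows "ccomp X \<phi> h'' [ccomp X \<psi>1 h' \<chi>s1, ccomp X \<psi>2 m' \<chi>s2] =
    ccomp X (ccomp X \<phi> h [\<psi>1, \<psi>2]) h' (\<chi>s1 @ \<chi>s2)"
proof -
  have "composable X \<phi> h [\<psi>1, \<psi>2] k"
    using assms(1-3) cell_inD(9,11)[OF assms(1)] cell_inD[OF assms(2)] cell_inD[OF assms(3)]
    by (auto simp: composable_def cell_in_def)
  then show ?thesis
    using comp_assoc[of \<phi> h "[\<psi>1, \<psi>2]" k h' "[\<chi>s1, \<chi>s2]" k'] assms(2,3,6,7)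
      cells_in_append[OF assms(4,5)] assms(4,5) cells_in_last[OF assms(4)]
    by (auto simp: cells_in_def cell_in_def)
qed

lemma comp_cid: "cell_in X \<phi> ps q f g \<Longrightarrow> ccomp X (cid X q) f [\<phi>] = \<phi>"
  using comp_id_left by (auto simp: cell_in_def)

lemma comp_cids: "cell_in X \<phi> ps q f g \<Longrightarrow> tdom X f = A \<Longrightarrow> ccomp X \<phi> (tid X A) (map (cid X) ps) = \<phi>"
  using comp_id_right by (auto simp: cell_in_def)

text \<open>Every identity absorbs its singleton block by the left unit law, and the boundary
  tight-cell stays an identity along \<open>rs\<close>, so only the last 2-cell changes.\<close>

lemma comps_cids:
  "loose_chain X L rs M \<Longrightarrow>
    comps X (tid X L) (map (cid X) rs @ [\<psi>]) (map (\<lambda>p. [cid X p]) rs @ [\<chi>s]) =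
    map (cid X) rs @ [ccomp X \<psi> (tid X M) \<chi>s]"
proof (induction rs arbitrary: L)
  case (Cons p rs)
  have p: "cell_in X (cid X p) [p] p (tid X L) (tid X (lsrc X p))"
    using Cons.prems by (intro cid_cell_in) auto
  show ?case using Cons comp_cid[OF p] cell_inD(5)[OF p] by simp
qed simp

text \<open>Associativity for 2-cells acting on the last slot alone: the slots of \<open>rs\<close>
  receive identities both times, so \<open>comps_cids\<close> evaluates the composite chain.\<close>

lemma assoc_cids:
  assumes \<alpha>: "cell_in X \<alpha> (rs @ [p]) q f g" and rs: "loose_chain X L rs M"
    and \<psi>: "cell_in X \<psi> qs p (tid X M) k"
    and \<chi>s: "cells_in X \<chi>s ps qs (tid X M) k'" and L: "tdom X f = L"
  shows "ccomp X \<alpha> (tid X L) (map (cid X) rs @ [ccomp X \<psi> (tid X M) \<chi>s]) =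
    ccomp X (ccomp X \<alpha> (tid X L) (map (cid X) rs @ [\<psi>])) (tid X L) (map (cid X) rs @ \<chi>s)"
proof -
  have Obj: "L \<in> Obj X" using rs loose_chain_Obj by blast
  have "cells_in X (map (cid X) rs @ [\<psi>]) (rs @ qs) (rs @ [p]) (tid X L) k"
    using cells_in_append[OF cells_in_ids[OF rs] cells_in_single[OF \<psi>]] .
  then have comp: "composable X \<alpha> (tid X L) (map (cid X) rs @ [\<psi>]) k"
    using \<alpha> L Obj by (simp add: composable_def cells_in_def cell_in_def)
  have *: "concat (map (\<lambda>p. [cid X p]) rs @ [\<chi>s]) = map (cid X) rs @ \<chi>s"
    by simp
  have chain: "cell_chain X (tid X L) (map (cid X) rs @ \<chi>s) k'"
    using cells_in_append[OF cells_in_ids[OF rs] \<chi>s] by (simp add: cells_in_def)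
  have "p \<in> Loose X" if "p \<in> set rs" for p
    using rs that by (induction rs arbitrary: L) auto
  then have "map (map (cbot X)) (map (\<lambda>p. [cid X p]) rs @ [\<chi>s]) =
      map (ctop X) (map (cid X) rs @ [\<psi>])"
    using \<psi> \<chi>s cid_in by (auto simp: cells_in_def cell_in_def)
  from comp_assoc[OF comp, of "tid X L" "map (\<lambda>p. [cid X p]) rs @ [\<chi>s]", unfolded *, OF chain this]
  show ?thesis using Obj comps_cids[OF rs] by simp
qed

lemma comp_cids_cell_in:
  assumes "cell_in X \<alpha> (rs @ [p]) q f g" "loose_chain X (tdom X f) rs M"
    and "cell_in X \<psi> qs p (tid X M) k"
  shows "cell_in X (ccomp X \<alpha> (tid X (tdom X f)) (map (cid X) rs @ [\<psi>])) (rs @ qs) q f (g \<cdot> k)"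
  using cells_in_append[OF cells_in_ids[OF assms(2)] cells_in_single[OF assms(3)]]
    loose_chain_Obj[OF assms(2)] cell_inD[OF assms(1)]
  by (intro comp_cell_in[OF assms(1)]) auto

end

subsection \<open>Loose-identities and restrictions\<close>

context virtual_equipment
begin

lemma
  assumes "A \<in> Obj X"
  shows lid_cell_opcartesian: "opcartesian X (lid_cell X A) [] (lid X A)"
    and lid_cell_in: "cell_in X (lid_cell X A) [] (lid X A) (tid X A) (tid X A)"
    and lid_simps [simp]: "lid X A \<in> Loose X" "ltgt X (lid X A) = A" "lsrc X (lid X A) = A"
proof -
  have *: "loose_identity X (lid_cell X A) A"
    unfolding lid_cell_def by (rule someI_ex) (rule ex_loose_identity[OF assms])
  then show "opcartesian X (lid_cell X A) [] (lid X A)"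
    by (simp add: loose_identity_def lid_def)
  with * show "cell_in X (lid_cell X A) [] (lid X A) (tid X A) (tid X A)"
    by (simp add: loose_identity_def opcartesian_def globular_def lid_def)
  from cell_inD[OF this] assms
  show "lid X A \<in> Loose X" "ltgt X (lid X A) = A" "lsrc X (lid X A) = A"
    by auto
qed

lemma lid_ex1:
  assumes "A \<in> Obj X" "cell_in X \<psi> (ps @ rs) q f g" "tdom X f = L"
    and "loose_chain X L (ps @ lid X A # rs) (tdom X g)"
  shows "\<exists>!\<chi>. cell_in X \<chi> (ps @ lid X A # rs) q f g \<and>
    ccomp X \<chi> (tid X L) (map (cid X) ps @ lid_cell X A # map (cid X) rs) = \<psi>"
  using lid_cell_opcartesian[OF assms(1), unfolded opcartesian_def, THEN conjunct2, rule_format,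
      of \<psi> ps rs] cell_inD[OF assms(2)] assms(3,4) by simp

text \<open>Uniqueness half of opcartesianness: both 2-cells factor the composite obtained by
  filling the slot of \<open>lid X A\<close> with the nullary unit.\<close>

lemma lid_ext:
  assumes A: "A \<in> Obj X" and \<chi>: "cell_in X \<chi> (ps @ lid X A # rs) q f g"
    and \<chi>': "cell_in X \<chi>' (ps @ lid X A # rs) q f g" and L: "tdom X f = L"
    and eq: "ccomp X \<chi> (tid X L) (map (cid X) ps @ lid_cell X A # map (cid X) rs) =
      ccomp X \<chi>' (tid X L) (map (cid X) ps @ lid_cell X A # map (cid X) rs)"
  shows "\<chi> = \<chi>'"
proof -
  let ?R = "tdom X g"
  have chain: "loose_chain X L (ps @ lid X A # rs) ?R"
    using cell_inD(11)[OF \<chi>] L by simp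
  then have ps: "loose_chain X L ps A" and rs: "loose_chain X A rs ?R"
    using A by (auto simp: loose_chain_append)
  have Obj: "L \<in> Obj X" "?R \<in> Obj X"
    using loose_chain_Obj[OF chain] by auto
  have "cells_in X (map (cid X) ps @ [lid_cell X A] @ map (cid X) rs) (ps @ [] @ rs)
      (ps @ [lid X A] @ rs) (tid X L) (tid X ?R)"
    by (intro cells_in_append cells_in_single) (rule cells_in_ids[OF ps] lid_cell_in[OF A] cells_in_ids[OF rs])+
  then have "cell_in X (ccomp X \<chi> (tid X L) (map (cid X) ps @ lid_cell X A # map (cid X) rs))
      (ps @ rs) q f g" (is "cell_in X ?\<psi> _ _ _ _")
    using comp_cell_in[OF \<chi>, of _ "ps @ rs" "tid X L" "tid X ?R"] cell_inD[OF \<chi>] L Obj by simp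
  from lid_ex1[OF A this L chain] \<chi> \<chi>' eq show ?thesis by metis
qed

section \<open>Unitors and unit laws\<close>

text \<open>The \<open>THE\<close> denotes: \<open>cid X q\<close> factors through the opcartesian
  2-cell inserted to the left of \<open>q\<close>, and \<open>lid_ext\<close> makes the
  factorisation unique.\<close>

lemma
  assumes q: "q \<in> Loose X" "ltgt X q = A" "lsrc X q = B"
  shows left_unitor_cell_in: "cell_in X (left_unitor X q) [lid X A, q] q (tid X A) (tid X B)"
    and left_unitor_comp: "ccomp X (left_unitor X q) (tid X A) [lid_cell X A, cid X q] = cid X q"
proof -
  have Obj: "A \<in> Obj X" "B \<in> Obj X" using q ltgt_Obj lsrc_Obj by auto
  let ?P = "\<lambda>\<kappa>. globular X \<kappa> [lid X (ltgt X q), q] q \<and>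
    ccomp X \<kappa> (tid X (ltgt X q)) [lid_cell X (ltgt X q), cid X q] = cid X q"
  have "\<exists>\<kappa>. ?P \<kappa>"
    using ex1_implies_ex[OF lid_ex1[OF Obj(1), of "cid X q" "[]" "[q]" q "tid X A" "tid X B"]] cid_cell_in[OF q] q Obj
    by (simp add: globular_def)
  moreover have "\<kappa> = \<kappa>'" if "?P \<kappa>" "?P \<kappa>'" for \<kappa> \<kappa>'
    by (rule lid_ext[OF Obj(1), of \<kappa> "[]" "[q]" q "tid X A" "tid X B" \<kappa>' A])
      (use that q Obj in \<open>simp_all add: globular_def\<close>)
  ultimately have "\<exists>!\<kappa>. ?P \<kappa>" by (rule ex_ex1I)
  then have "?P (left_unitor X q)"
    unfolding left_unitor_def by (rule theI'[of ?P])
  then show "cell_in X (left_unitor X q) [lid X A, q] q (tid X A) (tid X B)"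
    and "ccomp X (left_unitor X q) (tid X A) [lid_cell X A, cid X q] = cid X q"
    using q by (auto simp: globular_def)
qed

lemma right_unitor_exists:
  assumes q: "q \<in> Loose X" "ltgt X q = A" "lsrc X q = B"
  obtains \<rho> where "cell_in X \<rho> [q, lid X B] q (tid X A) (tid X B)"
    and "ccomp X \<rho> (tid X A) [cid X q, lid_cell X B] = cid X q"
proof -
  have Obj: "A \<in> Obj X" "B \<in> Obj X" using q ltgt_Obj lsrc_Obj by auto
  show ?thesis
    using that ex1_implies_ex[OF lid_ex1[OF Obj(2), of "cid X q" "[q]" "[]" q "tid X A" "tid X B" A]]
      cid_cell_in[OF q] q Obj by auto
qed

text \<open>This composite serves as the identity 2-cell on \<open>f\<close>.\<close>

lemma lid_cell_whisker:
  "f \<in> Tight X \<Longrightarrow> tcod X f = A \<Longrightarrow> cell_in X (ccomp X (lid_cell X A) f []) [] (lid X A) f f"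
  using tcod_Obj by (intro comp_cell_in[OF lid_cell_in cells_in_Nil]) auto

text \<open>With \<beta> written as \<open>cid X q\<close> composed with \<beta>, interchange over
  an empty first block moves \<beta> outside and leaves the defining equation of the unitor.\<close>

lemma left_unit:
  assumes \<beta>: "cell_in X \<beta> ps q f g" and A: "tcod X f = A"
  shows "ccomp X (left_unitor X q) f [ccomp X (lid_cell X A) f [], \<beta>] = \<beta>"
proof -
  note D = cell_inD[OF \<beta>]
  have Obj: "A \<in> Obj X" using tcod_Obj[OF D(6)] A by simp
  have q: "q \<in> Loose X" "ltgt X q = A" "lsrc X q = tcod X g" using D A by auto
  have "ccomp X (left_unitor X q) f [ccomp X (lid_cell X A) f [], ccomp X (cid X q) f [\<beta>]] =
    ccomp X (ccomp X (left_unitor X q) (tid X A) [lid_cell X A, cid X q]) f ([] @ [\<beta>])"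
    using Obj A D
    by (intro assoc2[OF left_unitor_cell_in[OF q] lid_cell_in[OF Obj] cid_cell_in[OF q]
      cells_in_Nil cells_in_single[OF \<beta>]]) auto
  then show ?thesis
    by (simp add: comp_cid[OF \<beta>] left_unitor_comp[OF q])
qed

text \<open>The left unitor of A(1,1) is also a right unitor. Filling the remaining slot with the
  unit makes both sides equal to \<open>lid_cell X A\<close>, so \<open>lid_ext\<close>
  applies.\<close>

lemma left_unitor_lid:
  assumes A: "A \<in> Obj X"
  shows "ccomp X (left_unitor X (lid X A)) (tid X A) [cid X (lid X A), lid_cell X A] = cid X (lid X A)"
proof -
  let ?I = "lid X A" and ?u = "lid_cell X A" and ?l = "left_unitor X (lid X A)"
  note I = lid_simps[OF A]
  note u = lid_cell_in[OF A] and c = cid_cell_in[OF I] and l = left_unitor_cell_in[OF I]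
  have T: "tid X A \<in> Tight X" using A by simp
  have m: "cell_in X (ccomp X ?l (tid X A) [cid X ?I, ?u]) [?I] ?I (tid X A) (tid X A)"
    using A by (intro comp2_cell_in[OF l c u]) auto
  have uu: "ccomp X ?u (tid X A) [] = ?u"
    using comp_cids[OF u] A by simp
  have "ccomp X ?l (tid X A) [ccomp X (cid X ?I) (tid X A) [?u], ccomp X ?u (tid X A) []] =
    ccomp X (ccomp X ?l (tid X A) [cid X ?I, ?u]) (tid X A) ([?u] @ [])"
    using A by (intro assoc2[OF l c u cells_in_single[OF u] cells_in_Nil]) auto
  then have "ccomp X (ccomp X ?l (tid X A) [cid X ?I, ?u]) (tid X A) [?u] = ccomp X (cid X ?I) (tid X A) [?u]"
    using left_unit[OF u, of A] A by (simp add: comp_cid[OF u] uu)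
  then show ?thesis
    by (intro lid_ext[OF A, of _ "[]" "[]" ?I "tid X A" "tid X A" "cid X ?I" A])
      (use m c A in simp_all)
qed

text \<open>Mirror image of \<open>left_unit\<close>, made possible by
  \<open>left_unitor_lid\<close>; the same 2-cell thus absorbs identity 2-cells on either
  side.\<close>

lemma right_unit_lid:
  assumes \<beta>: "cell_in X \<beta> ps (lid X E) f g" and E: "E \<in> Obj X"
  shows "ccomp X (left_unitor X (lid X E)) f [\<beta>, ccomp X (lid_cell X E) g []] = \<beta>"
proof -
  note D = cell_inD[OF \<beta>]
  note I = lid_simps[OF E]
  have "ccomp X (left_unitor X (lid X E)) f [ccomp X (cid X (lid X E)) f [\<beta>], ccomp X (lid_cell X E) g []] =
    ccomp X (ccomp X (left_unitor X (lid X E)) (tid X E) [cid X (lid X E), lid_cell X E]) f ([\<beta>] @ [])"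
    using E D
    by (intro assoc2[OF left_unitor_cell_in[OF I] cid_cell_in[OF I] lid_cell_in[OF E]
      cells_in_single[OF \<beta>] cells_in_Nil]) auto
  then show ?thesis
    by (simp add: comp_cid[OF \<beta>] left_unitor_lid[OF E])
qed

text \<open>
  Naturality of the right unitor; \<open>\<Theta>\<close> is the 2-cell \<open>C(1,1) \<Rightarrow> E(1,1)\<close> induced by \<open>g\<close>. Both sides
  agree after composition with the opcartesian 2-cell of \<open>C(1,1)\<close>.
\<close>

lemma right_unitor_natural:
  assumes \<alpha>: "cell_in X \<alpha> (rs @ [p]) (lid X E) f g"
    and p: "p \<in> Loose X" "ltgt X p = M" "lsrc X p = C"
    and \<Theta>: "cell_in X \<Theta> [lid X C] (lid X E) g g"
      "ccomp X \<Theta> (tid X C) [lid_cell X C] = ccomp X (lid_cell X E) g []"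
    and \<rho>: "cell_in X \<rho> [p, lid X C] p (tid X M) (tid X C)"
      "ccomp X \<rho> (tid X M) [cid X p, lid_cell X C] = cid X p"
    and L: "tdom X f = L" and E: "E \<in> Obj X"
  shows "ccomp X (left_unitor X (lid X E)) f [\<alpha>, \<Theta>] = ccomp X \<alpha> (tid X L) (map (cid X) rs @ [\<rho>])"
    (is "?a = ?b")
proof -
  note D = cell_inD[OF \<alpha>] and I = lid_simps[OF E]
  note l = left_unitor_cell_in[OF I]
  have Obj: "M \<in> Obj X" "C \<in> Obj X" using p ltgt_Obj lsrc_Obj by auto
  note u = lid_cell_in[OF Obj(2)]
  have ch: "loose_chain X L (rs @ [p]) (tdom X g)" using D(11) L by simp
  then have rs: "loose_chain X L rs M" and g: "tdom X g = C"
    using p by (auto simp: loose_chain_append)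
  have OL: "L \<in> Obj X" using rs loose_chain_Obj by blast
  have a: "cell_in X ?a (rs @ [p, lid X C]) (lid X E) f g"
    using D I by (intro comp2_cell_in[OF l \<alpha> \<Theta>(1)]) auto
  have b: "cell_in X ?b (rs @ [p, lid X C]) (lid X E) f g"
    using comp_cids_cell_in[OF \<alpha> _ \<rho>(1)] rs L g D by simp
  \<comment> \<open>Filling the last slot turns \<Theta> into the identity 2-cell on
    \<open>g\<close>, which the right unit law removes.\<close>
  have "ccomp X (left_unitor X (lid X E)) f
      [ccomp X \<alpha> (tid X L) (map (cid X) (rs @ [p])), ccomp X \<Theta> (tid X C) [lid_cell X C]] =
    ccomp X ?a (tid X L) (map (cid X) (rs @ [p]) @ [lid_cell X C])"
    using L OL D g cells_in_ids[OF ch]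
    by (intro assoc2[OF l \<alpha> \<Theta>(1) _ cells_in_single[OF u]]) auto
  then have 1: "ccomp X ?a (tid X L) (map (cid X) (rs @ [p]) @ [lid_cell X C]) = \<alpha>"
    by (simp only: \<Theta>(2) comp_cids[OF \<alpha> L] right_unit_lid[OF \<alpha> E])
  \<comment> \<open>Here the unit meets \<rho>, and the two cancel by the defining equation of
    \<rho>.\<close>
  have "ccomp X \<alpha> (tid X L) (map (cid X) rs @ [ccomp X \<rho> (tid X M) [cid X p, lid_cell X C]]) =
    ccomp X ?b (tid X L) (map (cid X) rs @ [cid X p, lid_cell X C])"
    by (rule assoc_cids[OF \<alpha> rs \<rho>(1) cells_in_pair[OF cid_cell_in[OF p] u, simplified] L])
  then have 2: "ccomp X ?b (tid X L) (map (cid X) (rs @ [p]) @ [lid_cell X C]) = \<alpha>"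
    using comp_cids[OF \<alpha> L] by (simp add: \<rho>(2))
  show ?thesis
    by (rule lid_ext[OF Obj(2), of _ "rs @ [p]" "[]" "lid X E" f g _ L]) (use a b L 1 2 in simp_all)
qed

section \<open>Restrictions of loose-identities\<close>

lemma
  assumes f: "tight_in X f A E" and g: "tight_in X g B E"
  shows hom_cartesian: "cartesian X (cart_cell X (lid X E) f g) (hom X f g) (lid X E) f g"
    and hom_cart_cell_in: "cell_in X (cart_cell X (lid X E) f g) [hom X f g] (lid X E) f g"
    and hom_simps: "hom X f g \<in> Loose X" "ltgt X (hom X f g) = A" "lsrc X (hom X f g) = B"
proof -
  have T: "f \<in> Tight X" "g \<in> Tight X" "tdom X f = A" "tdom X g = B" "tcod X f = E" "tcod X g = E"
    using f g by (auto simp: tight_in_def)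
  have E: "E \<in> Obj X" using T tcod_Obj by auto
  let ?c = "cart_cell X (lid X E) f g"
  have "\<exists>\<phi> p. cartesian X \<phi> p (lid X E) f g"
    using ex_restriction[of "lid X E" f g] T E by simp
  then have "\<exists>p. cartesian X ?c p (lid X E) f g"
    unfolding cart_cell_def by (rule someI_ex)
  then obtain p where p: "cartesian X ?c p (lid X E) f g" by blast
  \<comment> \<open>A cartesian 2-cell has a singleton domain, whose only member is what
    \<open>restr\<close> extracts with \<open>hd\<close>.\<close>
  moreover have "p = hom X f g"
    using p T by (simp add: cartesian_def cell_in_def hom_def restr_def)
  ultimately show "cartesian X ?c (hom X f g) (lid X E) f g" by simp
  then show c: "cell_in X ?c [hom X f g] (lid X E) f g" by (simp add: cartesian_def)
  show "hom X f g \<in> Loose X" "ltgt X (hom X f g) = A" "lsrc X (hom X f g) = B"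
    using cell_inD(11)[OF c] T by auto
qed

lemma hom_ex1:
  assumes "tight_in X f A E" "tight_in X g B E" "cell_in X \<psi> ps (lid X E) (f \<cdot> f') (g \<cdot> g')"
    and "tight_in X f' A' A" "tight_in X g' B' B"
  shows "\<exists>!\<chi>. cell_in X \<chi> ps (hom X f g) f' g' \<and> ccomp X (cart_cell X (lid X E) f g) f' [\<chi>] = \<psi>"
  using hom_cartesian[OF assms(1,2), unfolded cartesian_def, THEN conjunct2, rule_format,
      of f' g' \<psi>] cell_inD[OF assms(3)] assms(1,2,4,5) by (simp add: tight_in_def)

lemma hom_ext:
  assumes f: "tight_in X f A E" and g: "tight_in X g B E"
    and \<chi>: "cell_in X \<chi> ps (hom X f g) f' g'" and \<chi>': "cell_in X \<chi>' ps (hom X f g) f' g'"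
    and eq: "ccomp X (cart_cell X (lid X E) f g) f' [\<chi>] = ccomp X (cart_cell X (lid X E) f g) f' [\<chi>']"
  shows "\<chi> = \<chi>'"
proof -
  have "cell_in X (ccomp X (cart_cell X (lid X E) f g) f' [\<chi>]) ps (lid X E) (f \<cdot> f') (g \<cdot> g')"
    by (rule comp1_cell_in[OF hom_cart_cell_in[OF f g] \<chi> refl refl])
  from hom_ex1[OF f g this, of "tdom X f'" "tdom X g'"] cell_inD[OF \<chi>] hom_simps[OF f g] \<chi> \<chi>' eq
  show ?thesis by (auto simp: tight_in_def)
qed

subsection \<open>Conjoints\<close>

text \<open>The unit is the factorisation of the identity 2-cell on \<open>r\<close> through the
  counit, so the second equation is the first triangle identity.\<close>

lemma conjoint_unit_exists:
  assumes r: "tight_in X r C E"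
  obtains \<eta> where "cell_in X \<eta> [] (hom X r (tid X E)) (tid X C) r"
    and "ccomp X (cart_cell X (lid X E) r (tid X E)) (tid X C) [\<eta>] = ccomp X (lid_cell X E) r []"
proof -
  have T: "r \<in> Tight X" "tdom X r = C" "tcod X r = E" "C \<in> Obj X" "E \<in> Obj X"
    using r tdom_Obj tcod_Obj by (auto simp: tight_in_def)
  have i: "tight_in X (tid X E) E E" using T tid_in by simp
  have "cell_in X (ccomp X (lid_cell X E) r []) [] (lid X E) (r \<cdot> tid X C) (tid X E \<cdot> r)"
    using lid_cell_whisker[of r E] T by simp
  from ex1_implies_ex[OF hom_ex1[OF r i this tid_in[OF T(4)] r]] that show ?thesis by blast
qed

text \<open>First round trip: attaching the counit and then inserting the unit changes nothing,
  since the first triangle identity leaves an identity 2-cell on \<open>r\<close> beside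
  \<beta>.\<close>

lemma conjoint_counit_unit:
  assumes \<beta>: "cell_in X \<beta> rs (lid X E) f r" and r: "tight_in X r C E"
    and \<eta>: "cell_in X \<eta> [] (hom X r (tid X E)) (tid X C) r"
      "ccomp X (cart_cell X (lid X E) r (tid X E)) (tid X C) [\<eta>] = ccomp X (lid_cell X E) r []"
    and L: "tdom X f = L"
  shows "ccomp X (ccomp X (left_unitor X (lid X E)) f [\<beta>, cart_cell X (lid X E) r (tid X E)])
    (tid X L) (map (cid X) rs @ [\<eta>]) = \<beta>"
proof -
  have T: "r \<in> Tight X" "tdom X r = C" "tcod X r = E" "C \<in> Obj X" "E \<in> Obj X"
    using r tdom_Obj tcod_Obj by (auto simp: tight_in_def)
  have i: "tight_in X (tid X E) E E" using T tid_in by simp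
  note D = cell_inD[OF \<beta>]
  have rs: "loose_chain X L rs C" using D T L by simp
  have OL: "L \<in> Obj X" using rs loose_chain_Obj by blast
  have "ccomp X (left_unitor X (lid X E)) f
      [ccomp X \<beta> (tid X L) (map (cid X) rs), ccomp X (cart_cell X (lid X E) r (tid X E)) (tid X C) [\<eta>]] =
    ccomp X (ccomp X (left_unitor X (lid X E)) f [\<beta>, cart_cell X (lid X E) r (tid X E)])
      (tid X L) (map (cid X) rs @ [\<eta>])"
    using OL L D(6)
    by (intro assoc2[OF left_unitor_cell_in[OF lid_simps[OF T(5)]] \<beta> hom_cart_cell_in[OF r i]
      cells_in_ids[OF rs] cells_in_single[OF \<eta>(1)]]) auto
  then show ?thesis
    by (simp add: \<eta>(2) comp_cids[OF \<beta> L] right_unit_lid[OF \<beta> T(5)])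
qed

text \<open>Second triangle identity. As the counit is cartesian, it suffices to compare after
  composing with it; there naturality of \<rho> brings counit and unit together and the first
  triangle identity applies.\<close>

lemma conjoint_triangle:
  assumes r: "tight_in X r C E"
    and \<eta>: "cell_in X \<eta> [] (hom X r (tid X E)) (tid X C) r"
      "ccomp X (cart_cell X (lid X E) r (tid X E)) (tid X C) [\<eta>] = ccomp X (lid_cell X E) r []"
    and \<rho>: "cell_in X \<rho> [hom X r (tid X E), lid X E] (hom X r (tid X E)) (tid X C) (tid X E)"
      "ccomp X \<rho> (tid X C) [cid X (hom X r (tid X E)), lid_cell X E] = cid X (hom X r (tid X E))"
  shows "ccomp X \<rho> (tid X C) [\<eta>, cart_cell X (lid X E) r (tid X E)] = cid X (hom X r (tid X E))"
proof -
  let ?p = "hom X r (tid X E)" and ?\<epsilon> = "cart_cell X (lid X E) r (tid X E)"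
    and ?l = "left_unitor X (lid X E)"
  have T: "r \<in> Tight X" "tdom X r = C" "tcod X r = E" "C \<in> Obj X" "E \<in> Obj X"
    using r tdom_Obj tcod_Obj by (auto simp: tight_in_def)
  have i: "tight_in X (tid X E) E E" using T tid_in by simp
  note I = lid_simps[OF T(5)] and \<epsilon> = hom_cart_cell_in[OF r i] and p = hom_simps[OF r i]
  note l = left_unitor_cell_in[OF I] and u = lid_cell_in[OF T(5)]
  have c: "cell_in X (cid X (lid X E)) [lid X E] (lid X E) (tid X E) (tid X E)"
    by (rule cid_cell_in[OF I])
  have m: "cell_in X (ccomp X \<rho> (tid X C) [\<eta>, ?\<epsilon>]) [?p] ?p (tid X C) (tid X E)"
    using T by (intro comp2_cell_in[OF \<rho>(1) \<eta>(1) \<epsilon>]) auto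
  \<comment> \<open>This makes the identity on E(1,1) an admissible \<Theta> in
    \<open>right_unitor_natural\<close>, for the tight-cell \<open>tid X E\<close>.\<close>
  have "ccomp X (cid X (lid X E)) (tid X E) [lid_cell X E] = ccomp X (lid_cell X E) (tid X E) []"
    using comp_cid[OF u] comp_cids[OF u] T by simp
  then have nat: "ccomp X ?l r [?\<epsilon>, cid X (lid X E)] = ccomp X ?\<epsilon> (tid X C) [\<rho>]"
    using right_unitor_natural[of ?\<epsilon> "[]" ?p E r "tid X E" C E "cid X (lid X E)" \<rho> C]
      \<epsilon> p c \<rho> T by simp
  have "ccomp X ?\<epsilon> (tid X C) [ccomp X \<rho> (tid X C) [\<eta>, ?\<epsilon>]] =
      ccomp X (ccomp X ?\<epsilon> (tid X C) [\<rho>]) (tid X C) [\<eta>, ?\<epsilon>]"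
    using T cells_in_pair[OF \<eta>(1) \<epsilon>] by (intro assoc1[OF \<epsilon> \<rho>(1)]) auto
  also have "\<dots> = ccomp X (ccomp X ?l r [?\<epsilon>, cid X (lid X E)]) (tid X C) ([\<eta>] @ [?\<epsilon>])"
    by (simp add: nat)
  also have "\<dots> = ccomp X ?l r [ccomp X ?\<epsilon> (tid X C) [\<eta>], ccomp X (cid X (lid X E)) r [?\<epsilon>]]"
    using T by (intro assoc2[OF l \<epsilon> c cells_in_single[OF \<eta>(1)] cells_in_single[OF \<epsilon>], symmetric]) auto
  also have "\<dots> = ?\<epsilon>"
    using left_unit[OF \<epsilon> T(3)] by (simp add: \<eta>(2) comp_cid[OF \<epsilon>])
  also have "\<dots> = ccomp X ?\<epsilon> (tid X C) [cid X ?p]"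
    using comp_cids[OF \<epsilon> T(2)] by simp
  finally show ?thesis
    by (intro hom_ext[OF r i m cid_cell_in[OF p]])
qed

text \<open>Second round trip: naturality of the right unitor gathers unit and counit in the last
  slot of \<alpha>, where \<open>conjoint_triangle\<close> cancels them.\<close>

lemma conjoint_unit_counit:
  assumes \<alpha>: "cell_in X \<alpha> (rs @ [hom X r (tid X E)]) (lid X E) f (tid X E)" and r: "tight_in X r C E"
    and \<eta>: "cell_in X \<eta> [] (hom X r (tid X E)) (tid X C) r"
      "ccomp X (cart_cell X (lid X E) r (tid X E)) (tid X C) [\<eta>] = ccomp X (lid_cell X E) r []"
    and L: "tdom X f = L"
  shows "ccomp X (left_unitor X (lid X E)) f
    [ccomp X \<alpha> (tid X L) (map (cid X) rs @ [\<eta>]), cart_cell X (lid X E) r (tid X E)] = \<alpha>"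
proof -
  let ?p = "hom X r (tid X E)" and ?\<epsilon> = "cart_cell X (lid X E) r (tid X E)"
    and ?l = "left_unitor X (lid X E)"
  have T: "r \<in> Tight X" "tdom X r = C" "tcod X r = E" "C \<in> Obj X" "E \<in> Obj X"
    using r tdom_Obj tcod_Obj by (auto simp: tight_in_def)
  have i: "tight_in X (tid X E) E E" using T tid_in by simp
  note I = lid_simps[OF T(5)] and \<epsilon> = hom_cart_cell_in[OF r i] and p = hom_simps[OF r i]
  note l = left_unitor_cell_in[OF I] and u = lid_cell_in[OF T(5)] and D = cell_inD[OF \<alpha>]
  have c: "cell_in X (cid X (lid X E)) [lid X E] (lid X E) (tid X E) (tid X E)"
    by (rule cid_cell_in[OF I])
  have rs: "loose_chain X L rs C" using D(11) L p T by (auto simp: loose_chain_append)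
  have OL: "L \<in> Obj X" using rs loose_chain_Obj by blast
  obtain \<rho> where \<rho>: "cell_in X \<rho> [?p, lid X E] ?p (tid X C) (tid X E)"
      "ccomp X \<rho> (tid X C) [cid X ?p, lid_cell X E] = cid X ?p"
    using right_unitor_exists[OF p] by blast
  have "ccomp X (cid X (lid X E)) (tid X E) [lid_cell X E] = ccomp X (lid_cell X E) (tid X E) []"
    using comp_cid[OF u] comp_cids[OF u] T by simp
  then have nat: "ccomp X ?l f [\<alpha>, cid X (lid X E)] = ccomp X \<alpha> (tid X L) (map (cid X) rs @ [\<rho>])"
    by (intro right_unitor_natural[OF \<alpha> p c _ \<rho> L T(5)])
  have ids: "cells_in X (map (cid X) rs @ [\<eta>]) rs (rs @ [?p]) (tid X L) r"
    using cells_in_append[OF cells_in_ids[OF rs] cells_in_single[OF \<eta>(1)]] by simp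
  \<comment> \<open>An identity is placed under the counit so that interchange can pull \<eta> and
    the counit out together.\<close>
  have "ccomp X ?l f [ccomp X \<alpha> (tid X L) (map (cid X) rs @ [\<eta>]), ?\<epsilon>] =
      ccomp X ?l f [ccomp X \<alpha> (tid X L) (map (cid X) rs @ [\<eta>]), ccomp X (cid X (lid X E)) r [?\<epsilon>]]"
    by (simp add: comp_cid[OF \<epsilon>])
  also have "\<dots> = ccomp X (ccomp X ?l f [\<alpha>, cid X (lid X E)]) (tid X L) ((map (cid X) rs @ [\<eta>]) @ [?\<epsilon>])"
    using OL L D(6) by (intro assoc2[OF l \<alpha> c ids cells_in_single[OF \<epsilon>]]) auto
  also have "\<dots> = ccomp X (ccomp X \<alpha> (tid X L) (map (cid X) rs @ [\<rho>])) (tid X L) (map (cid X) rs @ [\<eta>, ?\<epsilon>])"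
    by (simp add: nat)
  also have "\<dots> = ccomp X \<alpha> (tid X L) (map (cid X) rs @ [ccomp X \<rho> (tid X C) [\<eta>, ?\<epsilon>]])"
    using cells_in_pair[OF \<eta>(1) \<epsilon>] by (intro assoc_cids[OF \<alpha> rs \<rho>(1) _ L, symmetric]) simp
  also have "\<dots> = \<alpha>"
    using comp_cids[OF \<alpha> L] by (simp add: conjoint_triangle[OF r \<eta> \<rho>])
  finally show ?thesis .
qed

end

subsection \<open>Relative adjunctions and left lifts\<close>

text \<open>Only the frames of the three tight-cells are fixed; no adjunction is assumed, so both
  directions can be proved here.\<close>

locale relative_adjunction_data = virtual_equipment X
  for X :: "('o, 't, 'l, 'c) vdc" (structure) +
  fixes j r l :: 't and A C E :: 'o
  assumes j: "tight_in X j A E" and r: "tight_in X r C E" and l: "tight_in X l A C"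
begin

lemma tight_simps [simp]:
  "j \<in> Tight X" "tdom X j = A" "tcod X j = E" "r \<in> Tight X" "tdom X r = C" "tcod X r = E"
  "l \<in> Tight X" "tdom X l = A" "tcod X l = C"
  using j r l by (auto simp: tight_in_def)

lemma Obj_simps [simp]: "A \<in> Obj X" "C \<in> Obj X" "E \<in> Obj X"
  using tdom_Obj[of j] tcod_Obj[of j] tdom_Obj[of r] by auto

lemma rl: "tight_in X (r \<cdot> l) A E" and iC: "tight_in X (tid X C) C C" and iE: "tight_in X (tid X E) E E"
  using tcomp_in[OF l r] by (auto intro: tid_in)

abbreviation "Cl \<equiv> hom X l (tid X C)"
abbreviation "Er \<equiv> hom X r (tid X E)"
abbreviation "\<epsilon>\<^sub>l \<equiv> cart_cell X (lid X C) l (tid X C)"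
abbreviation "\<epsilon>\<^sub>r \<equiv> cart_cell X (lid X E) r (tid X E)"
abbreviation "\<epsilon>\<^sub>j \<equiv> cart_cell X (lid X E) j (tid X E)"
abbreviation "\<gamma> \<equiv> cart_cell X (lid X E) j r"
abbreviation "\<mu> \<equiv> left_unitor X (lid X E)"

lemmas \<epsilon>_cell_in = hom_cart_cell_in[OF l iC] hom_cart_cell_in[OF r iE] hom_cart_cell_in[OF j iE]
lemmas \<gamma>_cell_in = hom_cart_cell_in[OF j r]
lemmas \<mu>_cell_in = left_unitor_cell_in[OF lid_simps[OF Obj_simps(3)]]

lemmas Cl_simps [simp] = hom_simps[OF l iC]
lemmas Er_simps [simp] = hom_simps[OF r iE]
lemmas Ej_simps [simp] = hom_simps[OF j iE]
lemmas hom_jr_simps [simp] = hom_simps[OF j r]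

text \<open>
  \<open>\<chi>\<close> and \<open>\<chi>'\<close> correspond under the bijection between 2-cells \<open>rs, E(r,1) \<Rightarrow> E(j,1)\<close> and 2-cells
  \<open>rs \<Rightarrow> E(j,r)\<close>, which presents \<open>E(j,r)\<close> as the right extension of \<open>E(j,1)\<close> along \<open>E(r,1)\<close>.
\<close>

definition transpose :: "'c \<Rightarrow> 'c \<Rightarrow> bool" where
  "transpose \<chi> \<chi>' \<longleftrightarrow> ccomp X \<epsilon>\<^sub>j (tid X A) [\<chi>] = ccomp X \<mu> j [ccomp X \<gamma> (tid X A) [\<chi>'], \<epsilon>\<^sub>r]"

lemma \<gamma>_comp_cell_in:
  "cell_in X \<chi>' rs (hom X j r) (tid X A) (tid X C) \<Longrightarrow>
    cell_in X (ccomp X \<gamma> (tid X A) [\<chi>']) rs (lid X E) j r"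
  by (rule comp1_cell_in[OF \<gamma>_cell_in]) auto

lemma \<mu>_comp_\<epsilon>_cell_in:
  "cell_in X \<beta> rs (lid X E) j r \<Longrightarrow>
    cell_in X (ccomp X \<mu> j [\<beta>, \<epsilon>\<^sub>r]) (rs @ [Er]) (lid X E) j (tid X E)"
  by (rule comp2_cell_in[OF \<mu>_cell_in _ \<epsilon>_cell_in(2)]) auto

text \<open>The right-hand side in \<open>transpose\<close> factors through the cartesian 2-cell
  \<open>\<epsilon>\<^sub>j\<close>.\<close>

lemma transpose_exists_left:
  assumes "cell_in X \<chi>' rs (hom X j r) (tid X A) (tid X C)"
  obtains \<chi> where "cell_in X \<chi> (rs @ [Er]) (hom X j (tid X E)) (tid X A) (tid X E)" "transpose \<chi> \<chi>'"
  using hom_ex1[OF j iE, of _ _ "tid X A" "tid X E" A E] \<mu>_comp_\<epsilon>_cell_in[OF \<gamma>_comp_cell_in[OF assms]]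
  unfolding transpose_def by (metis Obj_simps(1,3) tcomp_tid_simps(2) tid_in tight_simps(1,2) tid_simps(1,2))

lemma transpose_exists_right:
  assumes \<chi>: "cell_in X \<chi> (rs @ [Er]) (hom X j (tid X E)) (tid X A) (tid X E)"
  obtains \<chi>' where "cell_in X \<chi>' rs (hom X j r) (tid X A) (tid X C)" "transpose \<chi> \<chi>'"
proof -
  obtain \<eta>\<^sub>r where \<eta>\<^sub>r: "cell_in X \<eta>\<^sub>r [] Er (tid X C) r"
      "ccomp X \<epsilon>\<^sub>r (tid X C) [\<eta>\<^sub>r] = ccomp X (lid_cell X E) r []"
    using conjoint_unit_exists[OF r] by blast
  let ?\<alpha> = "ccomp X \<epsilon>\<^sub>j (tid X A) [\<chi>]"
  \<comment> \<open>Inserting the conjoint unit removes E(r,1) from the domain and makes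
    \<open>r\<close> the right tight-cell, so the result factors through \<gamma>.\<close>
  let ?\<beta> = "ccomp X ?\<alpha> (tid X A) (map (cid X) rs @ [\<eta>\<^sub>r])"
  have \<alpha>: "cell_in X ?\<alpha> (rs @ [Er]) (lid X E) j (tid X E)"
    by (rule comp1_cell_in[OF \<epsilon>_cell_in(3) \<chi>]) auto
  have rs: "loose_chain X A rs C"
    using cell_inD(11)[OF \<alpha>] by (auto simp: loose_chain_append)
  have "cell_in X ?\<beta> rs (lid X E) j r"
    using comp_cids_cell_in[OF \<alpha> _ \<eta>\<^sub>r(1)] rs by simp
  then have "\<exists>\<chi>'. cell_in X \<chi>' rs (hom X j r) (tid X A) (tid X C) \<and> ccomp X \<gamma> (tid X A) [\<chi>'] = ?\<beta>"
    by (intro ex1_implies_ex hom_ex1[OF j r]) (auto intro: tid_in)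
  moreover have "ccomp X \<mu> j [?\<beta>, \<epsilon>\<^sub>r] = ?\<alpha>"
    by (rule conjoint_unit_counit[OF \<alpha> r \<eta>\<^sub>r]) simp
  ultimately show ?thesis using that by (auto simp: transpose_def)
qed

lemma transpose_unique_left:
  assumes "transpose \<chi>1 \<chi>'" "transpose \<chi>2 \<chi>'"
    and "cell_in X \<chi>1 (rs @ [Er]) (hom X j (tid X E)) (tid X A) (tid X E)"
    and "cell_in X \<chi>2 (rs @ [Er]) (hom X j (tid X E)) (tid X A) (tid X E)"
  shows "\<chi>1 = \<chi>2"
  by (rule hom_ext[OF j iE assms(3,4)]) (use assms(1,2) in \<open>simp add: transpose_def\<close>)

text \<open>Inserting the conjoint unit recovers the composite with \<gamma> from the transpose, and
  \<gamma> is cartesian.\<close>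

lemma transpose_unique_right:
  assumes "transpose \<chi> \<chi>1" "transpose \<chi> \<chi>2"
    and 1: "cell_in X \<chi>1 rs (hom X j r) (tid X A) (tid X C)"
    and 2: "cell_in X \<chi>2 rs (hom X j r) (tid X A) (tid X C)"
  shows "\<chi>1 = \<chi>2"
proof (rule hom_ext[OF j r 1 2])
  obtain \<eta>\<^sub>r where \<eta>\<^sub>r: "cell_in X \<eta>\<^sub>r [] Er (tid X C) r"
      "ccomp X \<epsilon>\<^sub>r (tid X C) [\<eta>\<^sub>r] = ccomp X (lid_cell X E) r []"
    using conjoint_unit_exists[OF r] by blast
  show "ccomp X \<gamma> (tid X A) [\<chi>1] = ccomp X \<gamma> (tid X A) [\<chi>2]"
    using conjoint_counit_unit[OF \<gamma>_comp_cell_in[OF 1] r \<eta>\<^sub>r tight_simps(2)]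
      conjoint_counit_unit[OF \<gamma>_comp_cell_in[OF 2] r \<eta>\<^sub>r tight_simps(2)] assms(1,2)
    unfolding transpose_def by metis
qed

text \<open>Naturality of the bijection in the domain: \<psi> acts only on the slot beside E(r,1),
  so interchange carries it to the side of \<phi>.\<close>

lemma transpose_comp:
  assumes "transpose \<omega> \<phi>" and \<psi>: "cell_in X \<psi> rs s (tid X A) (tid X C)"
    and \<phi>: "cell_in X \<phi> [s] (hom X j r) (tid X A) (tid X C)"
    and \<omega>: "cell_in X \<omega> [s, Er] (hom X j (tid X E)) (tid X A) (tid X E)"
  shows "transpose (ccomp X \<omega> (tid X A) [\<psi>, cid X Er]) (ccomp X \<phi> (tid X A) [\<psi>])"
proof -
  have c: "cell_in X (cid X Er) [Er] Er (tid X C) (tid X E)"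
    by (rule cid_cell_in) auto
  have "ccomp X \<epsilon>\<^sub>j (tid X A) [ccomp X \<omega> (tid X A) [\<psi>, cid X Er]] =
      ccomp X (ccomp X \<epsilon>\<^sub>j (tid X A) [\<omega>]) (tid X A) [\<psi>, cid X Er]"
    by (rule assoc1[OF \<epsilon>_cell_in(3) \<omega> cells_in_pair[OF \<psi> c]]) auto
  also have "\<dots> = ccomp X (ccomp X \<mu> j [ccomp X \<gamma> (tid X A) [\<phi>], \<epsilon>\<^sub>r]) (tid X A) ([\<psi>] @ [cid X Er])"
    using assms(1) by (simp add: transpose_def)
  also have "\<dots> = ccomp X \<mu> j [ccomp X (ccomp X \<gamma> (tid X A) [\<phi>]) (tid X A) [\<psi>], ccomp X \<epsilon>\<^sub>r (tid X C) [cid X Er]]"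
    by (rule assoc2[OF \<mu>_cell_in \<gamma>_comp_cell_in[OF \<phi>] \<epsilon>_cell_in(2) cells_in_single[OF \<psi>]
      cells_in_single[OF c], symmetric]) auto
  also have "ccomp X \<epsilon>\<^sub>r (tid X C) [cid X Er] = \<epsilon>\<^sub>r"
    using comp_cids[OF \<epsilon>_cell_in(2)] by simp
  also have "ccomp X (ccomp X \<gamma> (tid X A) [\<phi>]) (tid X A) [\<psi>] = ccomp X \<gamma> (tid X A) [ccomp X \<phi> (tid X A) [\<psi>]]"
    by (rule assoc1[OF \<gamma>_cell_in \<phi> cells_in_single[OF \<psi>], symmetric]) auto
  finally show ?thesis by (simp add: transpose_def)
qed

section \<open>Right extensions and invertible 2-cells\<close>

text \<open>Transposition turns unique factorisation through \<omega> into unique factorisation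
  through \<phi> of all 2-cells into E(j,r), which amounts to invertibility of \<phi>.\<close>

lemma right_extension_iff_loose_iso:
  assumes tr: "transpose \<omega> \<phi>" and s: "s \<in> Loose X" "ltgt X s = A" "lsrc X s = C"
    and \<phi>: "cell_in X \<phi> [s] (hom X j r) (tid X A) (tid X C)"
    and \<omega>: "cell_in X \<omega> [s, Er] (hom X j (tid X E)) (tid X A) (tid X E)"
  shows "right_extension X s \<omega> (hom X j (tid X E)) Er \<longleftrightarrow> loose_iso X \<phi> s (hom X j r)"
proof -
  let ?q = "hom X j (tid X E)" and ?h = "hom X j r" and ?i = "tid X A"
  let ?ext = "\<lambda>\<psi>. ccomp X \<omega> ?i [\<psi>, cid X Er]"
  have \<phi>_comp: "cell_in X (ccomp X \<phi> ?i [\<psi>]) rs ?h ?i (tid X C)"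
    if "cell_in X \<psi> rs s ?i (tid X C)" for \<psi> rs
    by (rule comp1_cell_in[OF \<phi> that]) auto
  have \<omega>_comp: "cell_in X (?ext \<psi>) (rs @ [Er]) ?q ?i (tid X E)"
    if "cell_in X \<psi> rs s ?i (tid X C)" for \<psi> rs
    by (rule comp2_cell_in[OF \<omega> that cid_cell_in]) auto
  have ext_iff: "?ext \<psi> = \<chi> \<longleftrightarrow> ccomp X \<phi> ?i [\<psi>] = \<chi>'"
    if "transpose \<chi> \<chi>'" "cell_in X \<psi> rs s ?i (tid X C)"
      "cell_in X \<chi> (rs @ [Er]) ?q ?i (tid X E)" "cell_in X \<chi>' rs ?h ?i (tid X C)" for \<psi> \<chi> \<chi>' rs
    using transpose_comp[OF tr that(2) \<phi> \<omega>] transpose_unique_left[OF _ that(1) \<omega>_comp[OF that(2)] that(3)]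
      transpose_unique_right[OF _ that(1) \<phi>_comp[OF that(2)] that(4)] that(1) by metis
  have cs: "cell_in X (cid X s) [s] s ?i (tid X C)" and ch: "cell_in X (cid X ?h) [?h] ?h ?i (tid X C)"
    using s by (auto intro: cid_cell_in)
  show ?thesis
  proof
    assume R: "right_extension X s \<omega> ?q Er"
    have R: "\<exists>!\<psi>. cell_in X \<psi> rs s ?i (tid X C) \<and> ?ext \<psi> = \<chi>"
      if "cell_in X \<chi> (rs @ [Er]) ?q ?i (tid X E)" for \<chi> rs
      using R[unfolded right_extension_def globular_def, THEN conjunct2, rule_format, of \<chi> rs] that s
      by simp
    \<comment> \<open>The inverse of \<phi> is the factorisation of the 2-cell corresponding to the
      identity on E(j,r).\<close>
    obtain \<chi> where \<chi>: "cell_in X \<chi> ([?h] @ [Er]) ?q ?i (tid X E)" "transpose \<chi> (cid X ?h)"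
      using transpose_exists_left[OF ch] by blast
    obtain \<psi> where \<psi>: "cell_in X \<psi> [?h] s ?i (tid X C)" and "?ext \<psi> = \<chi>"
      using R[OF \<chi>(1)] by blast
    then have inv: "ccomp X \<phi> ?i [\<psi>] = cid X ?h"
      using ext_iff[OF \<chi>(2) \<psi> \<chi>(1) ch] by simp
    have \<psi>\<phi>: "cell_in X (ccomp X \<psi> ?i [\<phi>]) [s] s ?i (tid X C)"
      by (rule comp1_cell_in[OF \<psi> \<phi>]) auto
    have \<omega>': "cell_in X \<omega> ([s] @ [Er]) ?q ?i (tid X E)" using \<omega> by simp
    have "ccomp X \<phi> ?i [ccomp X \<psi> ?i [\<phi>]] = ccomp X (ccomp X \<phi> ?i [\<psi>]) ?i [\<phi>]"
      by (rule assoc1[OF \<phi> \<psi> cells_in_single[OF \<phi>]]) auto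
    then have "ccomp X \<phi> ?i [ccomp X \<psi> ?i [\<phi>]] = \<phi>"
      by (simp add: inv comp_cid[OF \<phi>])
    moreover have "ccomp X \<phi> ?i [cid X s] = \<phi>"
      using comp_cids[OF \<phi>] by simp
    \<comment> \<open>For the other composite, both candidates factor \<omega> through itself, so
      uniqueness identifies them.\<close>
    ultimately have "?ext (ccomp X \<psi> ?i [\<phi>]) = \<omega>" "?ext (cid X s) = \<omega>"
      using ext_iff[OF tr \<psi>\<phi> \<omega>' \<phi>] ext_iff[OF tr cs \<omega>' \<phi>] by auto
    then have "ccomp X \<psi> ?i [\<phi>] = cid X s"
      using R[OF \<omega>'] \<psi>\<phi> cs by blast
    with inv \<psi> \<phi> s show "loose_iso X \<phi> s ?h"
      by (auto simp: loose_iso_def globular_def)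
  next
    assume "loose_iso X \<phi> s ?h"
    then obtain \<theta> where \<theta>: "cell_in X \<theta> [?h] s ?i (tid X C)"
      and inv: "ccomp X \<theta> ?i [\<phi>] = cid X s" "ccomp X \<phi> ?i [\<theta>] = cid X ?h"
      using s by (auto simp: loose_iso_def globular_def)
    have "\<exists>!\<psi>. cell_in X \<psi> rs s ?i (tid X C) \<and> ?ext \<psi> = \<chi>"
      if \<chi>: "cell_in X \<chi> (rs @ [Er]) ?q ?i (tid X E)" for rs \<chi>
    proof -
      obtain \<chi>' where \<chi>': "cell_in X \<chi>' rs ?h ?i (tid X C)" "transpose \<chi> \<chi>'"
        using transpose_exists_right[OF \<chi>] by blast
      \<comment> \<open>Through an invertible \<phi>, the transpose of \<chi> factors by composing
        with the inverse.\<close>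
      let ?\<psi> = "ccomp X \<theta> ?i [\<chi>']"
      have \<psi>: "cell_in X ?\<psi> rs s ?i (tid X C)"
        by (rule comp1_cell_in[OF \<theta> \<chi>'(1)]) auto
      have "ccomp X \<phi> ?i [?\<psi>] = ccomp X (ccomp X \<phi> ?i [\<theta>]) ?i [\<chi>']"
        by (rule assoc1[OF \<phi> \<theta> cells_in_single[OF \<chi>'(1)]]) auto
      then have 1: "?ext ?\<psi> = \<chi>"
        using ext_iff[OF \<chi>'(2) \<psi> \<chi> \<chi>'(1)] by (simp add: inv comp_cid[OF \<chi>'(1)])
      have "\<psi>' = ?\<psi>" if \<psi>': "cell_in X \<psi>' rs s ?i (tid X C)" "?ext \<psi>' = \<chi>" for \<psi>'
      proof -
        have "ccomp X \<theta> ?i [ccomp X \<phi> ?i [\<psi>']] = ccomp X (ccomp X \<theta> ?i [\<phi>]) ?i [\<psi>']"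
          by (rule assoc1[OF \<theta> \<phi> cells_in_single[OF \<psi>'(1)]]) auto
        then show ?thesis
          using ext_iff[OF \<chi>'(2) \<psi>'(1) \<chi> \<chi>'(1)] \<psi>'(2) by (simp add: inv comp_cid[OF \<psi>'(1)])
      qed
      with \<psi> 1 show ?thesis by blast
    qed
    with \<omega> s show "right_extension X s \<omega> ?q Er"
      by (simp add: right_extension_def globular_def)
  qed
qed

section \<open>The 2-cell that a left lift makes a right extension\<close>

abbreviation "\<epsilon>\<^sub>r\<^sub>l \<equiv> cart_cell X (lid X E) (r \<cdot> l) (tid X E)"
abbreviation "\<delta> \<equiv> cart_cell X (lid X E) j (r \<cdot> l)"
abbreviation "\<nu> \<equiv> left_unitor X Er"

lemmas \<delta>_cell_in = hom_cart_cell_in[OF j rl]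
lemmas \<nu>_cell_in = left_unitor_cell_in[OF Er_simps]

text \<open>The composite C(l,1), E(r,1) \<rightarrow> E(1,1) whose factorisation is
  \<open>hom_opcart\<close>.\<close>

definition \<xi> :: 'c where
  "\<xi> = ccomp X \<epsilon>\<^sub>r l [ccomp X \<nu> l [\<epsilon>\<^sub>l, cid X Er]]"

lemma \<nu>_comp_cell_in: "cell_in X (ccomp X \<nu> l [\<epsilon>\<^sub>l, cid X Er]) [Cl, Er] Er l (tid X E)"
  by (rule comp2_cell_in[OF \<nu>_cell_in \<epsilon>_cell_in(1) cid_cell_in]) auto

lemma \<xi>_cell_in: "cell_in X \<xi> [Cl, Er] (lid X E) (r \<cdot> l) (tid X E)"
  unfolding \<xi>_def by (rule comp1_cell_in[OF \<epsilon>_cell_in(2) \<nu>_comp_cell_in]) auto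

lemma hom_opcart:
  shows hom_opcart_cell_in:
      "cell_in X (hom_opcart X l r) [Cl, Er] (hom X (r \<cdot> l) (tid X E)) (tid X A) (tid X E)"
    and hom_opcart_comp: "ccomp X \<epsilon>\<^sub>r\<^sub>l (tid X A) [hom_opcart X l r] = \<xi>"
proof -
  let ?P = "\<lambda>\<chi>. cell_in X \<chi> [Cl, Er] (hom X (r \<cdot> l) (tid X E)) (tid X A) (tid X E) \<and>
    ccomp X \<epsilon>\<^sub>r\<^sub>l (tid X A) [\<chi>] = \<xi>"
  have "hom_opcart X l r = (THE \<chi>. ?P \<chi>)"
    by (simp add: hom_opcart_def Let_def \<xi>_def globular_def hom_simps[OF rl iE])
  moreover have "\<exists>!\<chi>. ?P \<chi>"
    using \<xi>_cell_in by (intro hom_ex1[OF rl iE]) (auto intro: tid_in)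
  ultimately have "?P (hom_opcart X l r)"
    by (simp only:) (rule theI'[of ?P])
  then show "cell_in X (hom_opcart X l r) [Cl, Er] (hom X (r \<cdot> l) (tid X E)) (tid X A) (tid X E)"
    and "ccomp X \<epsilon>\<^sub>r\<^sub>l (tid X A) [hom_opcart X l r] = \<xi>" by auto
qed

lemma \<delta>_comp_cell_in:
  "cell_in X \<eta> [] (hom X j (r \<cdot> l)) (tid X A) (tid X A) \<Longrightarrow>
    cell_in X (ccomp X \<delta> (tid X A) [\<eta>]) [] (lid X E) j (r \<cdot> l)"
  by (rule comp1_cell_in[OF \<delta>_cell_in]) auto

lemma restr_2cell:
  assumes \<eta>: "cell_in X \<eta> [] (hom X j (r \<cdot> l)) (tid X A) (tid X A)"
  defines "\<kappa> \<equiv> restr_2cell X (lid X E) \<eta> j (r \<cdot> l) (tid X E)"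
  shows restr_2cell_cell_in:
      "cell_in X \<kappa> [hom X (r \<cdot> l) (tid X E)] (hom X j (tid X E)) (tid X A) (tid X E)"
    and restr_2cell_comp:
      "ccomp X \<epsilon>\<^sub>j (tid X A) [\<kappa>] = ccomp X \<mu> j [ccomp X \<delta> (tid X A) [\<eta>], \<epsilon>\<^sub>r\<^sub>l]"
proof -
  let ?P = "\<lambda>\<kappa>. cell_in X \<kappa> [hom X (r \<cdot> l) (tid X E)] (hom X j (tid X E)) (tid X A) (tid X E) \<and>
    ccomp X \<epsilon>\<^sub>j (tid X A) [\<kappa>] = ccomp X \<mu> j [ccomp X \<delta> (tid X A) [\<eta>], \<epsilon>\<^sub>r\<^sub>l]"
  have h: "restr X (lid X E) (r \<cdot> l) (tid X E) = hom X (r \<cdot> l) (tid X E)"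
    "restr X (lid X E) j (tid X E) = hom X j (tid X E)"
    by (simp_all add: hom_def)
  have "\<kappa> = (THE \<kappa>. ?P \<kappa>)"
    unfolding \<kappa>_def restr_2cell_def h globular_def by simp
  moreover have "cell_in X (ccomp X \<mu> j [ccomp X \<delta> (tid X A) [\<eta>], \<epsilon>\<^sub>r\<^sub>l])
      [hom X (r \<cdot> l) (tid X E)] (lid X E) (j \<cdot> tid X A) (tid X E \<cdot> tid X E)"
    by (rule comp2_cell_in[OF \<mu>_cell_in \<delta>_comp_cell_in[OF \<eta>] hom_cart_cell_in[OF rl iE]]) auto
  then have "\<exists>!\<kappa>. ?P \<kappa>"
    by (rule hom_ex1[OF j iE]) (auto intro: tid_in)
  ultimately have "?P \<kappa>"
    by (simp only:) (rule theI'[of ?P])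
  then show "cell_in X \<kappa> [hom X (r \<cdot> l) (tid X E)] (hom X j (tid X E)) (tid X A) (tid X E)"
    and "ccomp X \<epsilon>\<^sub>j (tid X A) [\<kappa>] = ccomp X \<mu> j [ccomp X \<delta> (tid X A) [\<eta>], \<epsilon>\<^sub>r\<^sub>l]" by auto
qed

text \<open>The candidate right extension in \<open>left_lift\<close>.\<close>

definition lift_cell :: "'c \<Rightarrow> 'c" where
  "lift_cell \<eta> = ccomp X (restr_2cell X (lid X E) \<eta> j (r \<cdot> l) (tid X E)) (tid X A) [hom_opcart X l r]"

text \<open>Composing with \<open>\<epsilon>\<^sub>j\<close> unwinds both factorisations, that of
  \<open>restr_2cell\<close> and that of \<open>hom_opcart\<close>, leaving explicit
  pastings.\<close>

lemma
  assumes \<eta>: "cell_in X \<eta> [] (hom X j (r \<cdot> l)) (tid X A) (tid X A)"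
  shows lift_cell_in: "cell_in X (lift_cell \<eta>) [Cl, Er] (hom X j (tid X E)) (tid X A) (tid X E)"
    and lift_cell_comp:
      "ccomp X \<epsilon>\<^sub>j (tid X A) [lift_cell \<eta>] = ccomp X \<mu> j [ccomp X \<delta> (tid X A) [\<eta>], \<xi>]"
proof -
  note \<kappa> = restr_2cell_cell_in[OF \<eta>] and h = hom_opcart_cell_in and \<eta>' = \<delta>_comp_cell_in[OF \<eta>]
  let ?\<kappa> = "restr_2cell X (lid X E) \<eta> j (r \<cdot> l) (tid X E)" and ?\<eta>' = "ccomp X \<delta> (tid X A) [\<eta>]"
  show "cell_in X (lift_cell \<eta>) [Cl, Er] (hom X j (tid X E)) (tid X A) (tid X E)"
    unfolding lift_cell_def by (rule comp1_cell_in[OF \<kappa> h]) auto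
  have "ccomp X \<epsilon>\<^sub>j (tid X A) [lift_cell \<eta>] = ccomp X (ccomp X \<epsilon>\<^sub>j (tid X A) [?\<kappa>]) (tid X A) [hom_opcart X l r]"
    unfolding lift_cell_def by (rule assoc1[OF \<epsilon>_cell_in(3) \<kappa> cells_in_single[OF h]]) auto
  also have "\<dots> = ccomp X (ccomp X \<mu> j [?\<eta>', \<epsilon>\<^sub>r\<^sub>l]) (tid X A) ([] @ [hom_opcart X l r])"
    by (simp add: restr_2cell_comp[OF \<eta>])
  also have "\<dots> = ccomp X \<mu> j [ccomp X ?\<eta>' (tid X A) [], ccomp X \<epsilon>\<^sub>r\<^sub>l (tid X A) [hom_opcart X l r]]"
    by (rule assoc2[OF \<mu>_cell_in \<eta>' hom_cart_cell_in[OF rl iE] cells_in_Nil cells_in_single[OF h], symmetric]) auto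
  also have "ccomp X ?\<eta>' (tid X A) [] = ?\<eta>'"
    using comp_cids[OF \<eta>'] by simp
  finally show "ccomp X \<epsilon>\<^sub>j (tid X A) [lift_cell \<eta>] = ccomp X \<mu> j [?\<eta>', \<xi>]"
    by (simp only: hom_opcart_comp)
qed

section \<open>Matching 2-cells j \<Rightarrow> rl with 2-cells C(l,1) \<Rightarrow> E(j,r)\<close>

text \<open>Here \<Theta> is the action of \<open>r\<close> on loose-identities. The last clause
  describes the transpose of \<open>lift_cell \<eta>\<close>: paste \<eta> with the image under
  \<open>r\<close> of the counit of C(l,1).\<close>

lemma loose_identity_map_exists:
  obtains \<Theta> where "cell_in X \<Theta> [lid X C] (lid X E) r r"
    and "ccomp X \<Theta> (tid X C) [lid_cell X C] = ccomp X (lid_cell X E) r []"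
    and "\<And>\<eta> \<phi>. cell_in X \<eta> [] (hom X j (r \<cdot> l)) (tid X A) (tid X A) \<Longrightarrow>
      ccomp X \<gamma> (tid X A) [\<phi>] = ccomp X \<mu> j [ccomp X \<delta> (tid X A) [\<eta>], ccomp X \<Theta> l [\<epsilon>\<^sub>l]] \<Longrightarrow>
      transpose (lift_cell \<eta>) \<phi>"
proof -
  obtain \<eta>\<^sub>r where \<eta>\<^sub>r: "cell_in X \<eta>\<^sub>r [] Er (tid X C) r"
      "ccomp X \<epsilon>\<^sub>r (tid X C) [\<eta>\<^sub>r] = ccomp X (lid_cell X E) r []"
    using conjoint_unit_exists[OF r] by blast
  \<comment> \<open>Building \<Theta> from the unit and counit of E(r,1) makes it directly
    comparable with \<xi>, which uses the same \<nu> and \<open>\<epsilon>\<^sub>r\<close>.\<close>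
  let ?N = "ccomp X \<nu> (tid X C) [cid X (lid X C), \<eta>\<^sub>r]"
  let ?\<Theta> = "ccomp X \<epsilon>\<^sub>r (tid X C) [?N]"
  have c: "cell_in X (cid X (lid X C)) [lid X C] (lid X C) (tid X C) (tid X C)"
    and cs: "cell_in X (cid X Cl) [Cl] Cl (tid X A) (tid X C)"
    and cp: "cell_in X (cid X Er) [Er] Er (tid X C) (tid X E)"
    by (auto intro!: cid_cell_in)
  note u = lid_cell_in[OF Obj_simps(2)]
  have N: "cell_in X ?N [lid X C] Er (tid X C) r"
    by (rule comp2_cell_in[OF \<nu>_cell_in c \<eta>\<^sub>r(1)]) auto
  have \<Theta>: "cell_in X ?\<Theta> [lid X C] (lid X E) r r"
    by (rule comp1_cell_in[OF \<epsilon>_cell_in(2) N]) auto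
  have \<eta>\<^sub>r_id: "ccomp X \<eta>\<^sub>r (tid X C) [] = \<eta>\<^sub>r"
    using comp_cids[OF \<eta>\<^sub>r(1)] by simp
  have u_id: "ccomp X (lid_cell X C) (tid X C) [] = lid_cell X C"
    using comp_cids[OF u] by simp
  have N_comp: "ccomp X ?N h [\<phi>] = ccomp X \<nu> h [\<phi>, \<eta>\<^sub>r]"
    if \<phi>: "cell_in X \<phi> ps (lid X C) h (tid X C)" for \<phi> ps h
  proof -
    have "ccomp X ?N h ([\<phi>] @ []) = ccomp X \<nu> h [ccomp X (cid X (lid X C)) h [\<phi>], ccomp X \<eta>\<^sub>r (tid X C) []]"
      using cell_inD(6)[OF \<phi>] cell_inD(9)[OF \<phi>, symmetric]
      by (intro assoc2[OF \<nu>_cell_in c \<eta>\<^sub>r(1) cells_in_single[OF \<phi>] cells_in_Nil, symmetric]) simp_all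
    then show ?thesis by (simp add: comp_cid[OF \<phi>] \<eta>\<^sub>r_id)
  qed
  have "ccomp X ?\<Theta> (tid X C) [lid_cell X C] = ccomp X \<epsilon>\<^sub>r (tid X C) [ccomp X ?N (tid X C) [lid_cell X C]]"
    by (rule assoc1[OF \<epsilon>_cell_in(2) N cells_in_single[OF u], symmetric]) auto
  moreover have "ccomp X ?N (tid X C) [lid_cell X C] = \<eta>\<^sub>r"
    using left_unit[OF \<eta>\<^sub>r(1), of C] by (simp add: N_comp[OF u] u_id)
  ultimately have \<Theta>u: "ccomp X ?\<Theta> (tid X C) [lid_cell X C] = ccomp X (lid_cell X E) r []"
    by (simp add: \<eta>\<^sub>r(2))
  \<comment> \<open>Filling the slot of E(r,1) in \<xi> with the conjoint unit leaves
    \<open>r\<close> applied to the counit of C(l,1).\<close>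
  have "ccomp X \<xi> (tid X A) [cid X Cl, \<eta>\<^sub>r] =
      ccomp X \<epsilon>\<^sub>r l [ccomp X (ccomp X \<nu> l [\<epsilon>\<^sub>l, cid X Er]) (tid X A) ([cid X Cl] @ [\<eta>\<^sub>r])]"
    using assoc1[OF \<epsilon>_cell_in(2) \<nu>_comp_cell_in cells_in_pair[OF cs \<eta>\<^sub>r(1)], of l]
    by (simp add: \<xi>_def)
  also have "ccomp X (ccomp X \<nu> l [\<epsilon>\<^sub>l, cid X Er]) (tid X A) ([cid X Cl] @ [\<eta>\<^sub>r]) =
      ccomp X \<nu> l [ccomp X \<epsilon>\<^sub>l (tid X A) [cid X Cl], ccomp X (cid X Er) (tid X C) [\<eta>\<^sub>r]]"
    by (rule assoc2[OF \<nu>_cell_in \<epsilon>_cell_in(1) cp cells_in_single[OF cs] cells_in_single[OF \<eta>\<^sub>r(1)], symmetric]) auto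
  also have "\<dots> = ccomp X ?N l [\<epsilon>\<^sub>l]"
    using comp_cids[OF \<epsilon>_cell_in(1)] by (simp add: comp_cid[OF \<eta>\<^sub>r(1)] N_comp[OF \<epsilon>_cell_in(1)])
  also have "ccomp X \<epsilon>\<^sub>r l [\<dots>] = ccomp X ?\<Theta> l [\<epsilon>\<^sub>l]"
    by (rule assoc1[OF \<epsilon>_cell_in(2) N cells_in_single[OF \<epsilon>_cell_in(1)]]) auto
  finally have \<xi>_comp: "ccomp X \<xi> (tid X A) [cid X Cl, \<eta>\<^sub>r] = ccomp X ?\<Theta> l [\<epsilon>\<^sub>l]" .
  have "transpose (lift_cell \<eta>) \<phi>"
    if \<eta>: "cell_in X \<eta> [] (hom X j (r \<cdot> l)) (tid X A) (tid X A)"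
      and \<phi>: "ccomp X \<gamma> (tid X A) [\<phi>] = ccomp X \<mu> j [ccomp X \<delta> (tid X A) [\<eta>], ccomp X ?\<Theta> l [\<epsilon>\<^sub>l]]" for \<eta> \<phi>
  proof -
    note \<eta>' = \<delta>_comp_cell_in[OF \<eta>]
    let ?\<eta>' = "ccomp X \<delta> (tid X A) [\<eta>]" and ?\<alpha> = "ccomp X \<epsilon>\<^sub>j (tid X A) [lift_cell \<eta>]"
    have \<alpha>: "cell_in X ?\<alpha> ([Cl] @ [Er]) (lid X E) j (tid X E)"
      by (rule comp1_cell_in[OF \<epsilon>_cell_in(3)]) (use lift_cell_in[OF \<eta>] in auto)
    \<comment> \<open>By \<open>conjoint_unit_counit\<close>, \<open>?\<alpha>\<close> is recovered
      from its composite with the conjoint unit, so that composite need only be identified with the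
      one of \<gamma> and \<phi>.\<close>
    have "ccomp X \<mu> j [ccomp X ?\<eta>' (tid X A) [], ccomp X \<xi> (tid X A) [cid X Cl, \<eta>\<^sub>r]] =
        ccomp X (ccomp X \<mu> j [?\<eta>', \<xi>]) (tid X A) ([] @ [cid X Cl, \<eta>\<^sub>r])"
      using cells_in_pair[OF cs \<eta>\<^sub>r(1)] by (intro assoc2[OF \<mu>_cell_in \<eta>' \<xi>_cell_in cells_in_Nil]) auto
    then have "ccomp X ?\<alpha> (tid X A) [cid X Cl, \<eta>\<^sub>r] = ccomp X \<gamma> (tid X A) [\<phi>]"
      using comp_cids[OF \<eta>'] by (simp add: \<xi>_comp lift_cell_comp[OF \<eta>] \<phi>)
    with conjoint_unit_counit[OF \<alpha> r \<eta>\<^sub>r tight_simps(2)] show ?thesis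
      by (simp add: transpose_def)
  qed
  with that \<Theta> \<Theta>u show ?thesis by blast
qed

text \<open>A form of the Yoneda lemma: \<open>\<eta>\<close> is the restriction of \<open>\<beta>\<close> along the unit \<open>() \<Rightarrow> C(l,l)\<close>.\<close>

lemma unit_exists:
  assumes \<beta>: "cell_in X \<beta> [Cl] (lid X E) j r"
    and \<Theta>: "cell_in X \<Theta> [lid X C] (lid X E) r r"
      "ccomp X \<Theta> (tid X C) [lid_cell X C] = ccomp X (lid_cell X E) r []"
  obtains \<eta> where "cell_in X \<eta> [] (hom X j (r \<cdot> l)) (tid X A) (tid X A)"
    and "ccomp X \<mu> j [ccomp X \<delta> (tid X A) [\<eta>], ccomp X \<Theta> l [\<epsilon>\<^sub>l]] = \<beta>"
proof -
  obtain \<eta>\<^sub>l where \<eta>\<^sub>l: "cell_in X \<eta>\<^sub>l [] Cl (tid X A) l"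
      "ccomp X \<epsilon>\<^sub>l (tid X A) [\<eta>\<^sub>l] = ccomp X (lid_cell X C) l []"
    using conjoint_unit_exists[OF l] by blast
  obtain \<rho> where \<rho>: "cell_in X \<rho> [Cl, lid X C] Cl (tid X A) (tid X C)"
      "ccomp X \<rho> (tid X A) [cid X Cl, lid_cell X C] = cid X Cl"
    using right_unitor_exists[OF Cl_simps] by blast
  let ?\<beta>' = "ccomp X \<beta> (tid X A) [\<eta>\<^sub>l]"
  have "cell_in X ?\<beta>' [] (lid X E) (j \<cdot> tid X A) ((r \<cdot> l) \<cdot> tid X A)"
    by (rule comp1_cell_in[OF \<beta> \<eta>\<^sub>l(1)]) auto
  then have "\<exists>\<eta>. cell_in X \<eta> [] (hom X j (r \<cdot> l)) (tid X A) (tid X A) \<and> ccomp X \<delta> (tid X A) [\<eta>] = ?\<beta>'"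
    by (intro ex1_implies_ex hom_ex1[OF j rl]) (auto intro: tid_in)
  moreover have "ccomp X \<mu> j [?\<beta>', ccomp X \<Theta> l [\<epsilon>\<^sub>l]] = \<beta>"
  proof -
    have \<beta>0: "cell_in X \<beta> ([] @ [Cl]) (lid X E) j r" using \<beta> by simp
    \<comment> \<open>Unit and counit of C(l,1) are pulled out, naturality trades \<Theta> for
      \<rho>, and the second triangle identity for \<open>l\<close> cancels the rest.\<close>
    have "ccomp X \<mu> j [?\<beta>', ccomp X \<Theta> l [\<epsilon>\<^sub>l]] = ccomp X (ccomp X \<mu> j [\<beta>, \<Theta>]) (tid X A) ([\<eta>\<^sub>l] @ [\<epsilon>\<^sub>l])"
      by (rule assoc2[OF \<mu>_cell_in \<beta> \<Theta>(1) cells_in_single[OF \<eta>\<^sub>l(1)] cells_in_single[OF \<epsilon>_cell_in(1)]]) auto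
    also have "ccomp X \<mu> j [\<beta>, \<Theta>] = ccomp X \<beta> (tid X A) (map (cid X) [] @ [\<rho>])"
      by (rule right_unitor_natural[OF \<beta>0 Cl_simps \<Theta> \<rho>]) auto
    also have "ccomp X (ccomp X \<beta> (tid X A) (map (cid X) [] @ [\<rho>])) (tid X A) ([\<eta>\<^sub>l] @ [\<epsilon>\<^sub>l]) =
        ccomp X \<beta> (tid X A) [ccomp X \<rho> (tid X A) [\<eta>\<^sub>l, \<epsilon>\<^sub>l]]"
      using assoc1[OF \<beta> \<rho>(1) cells_in_pair[OF \<eta>\<^sub>l(1) \<epsilon>_cell_in(1)], of "tid X A"] by simp
    also have "\<dots> = \<beta>"
      using comp_cids[OF \<beta>] by (simp add: conjoint_triangle[OF l \<eta>\<^sub>l \<rho>])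
    finally show ?thesis .
  qed
  ultimately show ?thesis using that by auto
qed

section \<open>The equivalence\<close>

text \<open>The objects quantified in the definition are determined by the domains and codomains of
  the tight-cells.\<close>

lemma relative_adjunction_iff:
  "relative_adjunction X j l r \<phi> \<longleftrightarrow> loose_iso X \<phi> Cl (hom X j r)"
  using j l r by (auto simp: relative_adjunction_def tight_in_def)

lemma left_lift_iff:
  "left_lift X j r l \<eta> \<longleftrightarrow> cell_in X \<eta> [] (hom X j (r \<cdot> l)) (tid X A) (tid X A) \<and>
     right_extension X Cl (lift_cell \<eta>) (hom X j (tid X E)) Er"
  using j l r by (auto simp: left_lift_def tight_in_def tight_2cell_def globular_def lift_cell_def
      hom_simps[OF j rl])

text \<open>Once \<phi> and \<open>lift_cell \<eta>\<close> are transposes,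
  \<open>right_extension_iff_loose_iso\<close> settles both directions; each direction has to
  produce the missing partner.\<close>

theorem relative_adjunction_iff_left_lift:
  "(\<exists>\<phi>. relative_adjunction X j l r \<phi>) \<longleftrightarrow> (\<exists>\<eta>. left_lift X j r l \<eta>)"
proof -
  obtain \<Theta> where \<Theta>: "cell_in X \<Theta> [lid X C] (lid X E) r r"
      "ccomp X \<Theta> (tid X C) [lid_cell X C] = ccomp X (lid_cell X E) r []"
    and tr: "\<And>\<eta> \<phi>. cell_in X \<eta> [] (hom X j (r \<cdot> l)) (tid X A) (tid X A) \<Longrightarrow>
      ccomp X \<gamma> (tid X A) [\<phi>] = ccomp X \<mu> j [ccomp X \<delta> (tid X A) [\<eta>], ccomp X \<Theta> l [\<epsilon>\<^sub>l]] \<Longrightarrow>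
      transpose (lift_cell \<eta>) \<phi>"
    using loose_identity_map_exists by blast
  show ?thesis
  proof
    assume "\<exists>\<phi>. relative_adjunction X j l r \<phi>"
    then obtain \<phi> where iso: "loose_iso X \<phi> Cl (hom X j r)"
      by (auto simp: relative_adjunction_iff)
    then have \<phi>: "cell_in X \<phi> [Cl] (hom X j r) (tid X A) (tid X C)"
      by (simp add: loose_iso_def globular_def)
    \<comment> \<open>The Yoneda argument supplies the partner \<eta> of \<phi>.\<close>
    obtain \<eta> where \<eta>: "cell_in X \<eta> [] (hom X j (r \<cdot> l)) (tid X A) (tid X A)"
      and eq: "ccomp X \<mu> j [ccomp X \<delta> (tid X A) [\<eta>], ccomp X \<Theta> l [\<epsilon>\<^sub>l]] = ccomp X \<gamma> (tid X A) [\<phi>]"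
      using unit_exists[OF \<gamma>_comp_cell_in[OF \<phi>] \<Theta>] by blast
    show "\<exists>\<eta>. left_lift X j r l \<eta>"
      using right_extension_iff_loose_iso[OF tr[OF \<eta> eq[symmetric]] Cl_simps \<phi> lift_cell_in[OF \<eta>]]
        iso \<eta> by (auto simp: left_lift_iff)
  next
    assume "\<exists>\<eta>. left_lift X j r l \<eta>"
    then obtain \<eta> where \<eta>: "cell_in X \<eta> [] (hom X j (r \<cdot> l)) (tid X A) (tid X A)"
      and ext: "right_extension X Cl (lift_cell \<eta>) (hom X j (tid X E)) Er"
      by (auto simp: left_lift_iff)
    have "cell_in X \<Theta> [lid X C] (lid X E) r r" by (rule \<Theta>)
    then have "cell_in X (ccomp X \<Theta> l [\<epsilon>\<^sub>l]) [Cl] (lid X E) (r \<cdot> l) (r \<cdot> tid X C)"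
      by (rule comp1_cell_in[OF _ \<epsilon>_cell_in(1)]) auto
    then have "cell_in X (ccomp X \<mu> j [ccomp X \<delta> (tid X A) [\<eta>], ccomp X \<Theta> l [\<epsilon>\<^sub>l]]) [Cl] (lid X E)
        (j \<cdot> tid X A) (r \<cdot> tid X C)"
      by (intro comp2_cell_in[OF \<mu>_cell_in \<delta>_comp_cell_in[OF \<eta>]]) auto
    \<comment> \<open>The partner \<phi> of \<eta> is the factorisation of the pasting through the
      cartesian 2-cell \<gamma>.\<close>
    from ex1_implies_ex[OF hom_ex1[OF j r this]]
    obtain \<phi> where \<phi>: "cell_in X \<phi> [Cl] (hom X j r) (tid X A) (tid X C)"
      and eq: "ccomp X \<gamma> (tid X A) [\<phi>] = ccomp X \<mu> j [ccomp X \<delta> (tid X A) [\<eta>], ccomp X \<Theta> l [\<epsilon>\<^sub>l]]"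
      using tid_in[of A] tid_in[of C] by auto
    show "\<exists>\<phi>. relative_adjunction X j l r \<phi>"
      using right_extension_iff_loose_iso[OF tr[OF \<eta> eq] Cl_simps \<phi> lift_cell_in[OF \<eta>]] ext
      by (auto simp: relative_adjunction_iff)
  qed
qed

end

theorem proposition5p8:
  fixes X :: "('o, 't, 'l, 'c) vdc"
  assumes "virtual_equipment X"
    and "tight_in X j A E" and "tight_in X r C E" and "tight_in X l A C"
  shows "(\<exists>\<phi>. relative_adjunction X j l r \<phi>) \<longleftrightarrow> (\<exists>\<eta>. left_lift X j r l \<eta>)"
proof -
  interpret virtual_equipment X by fact
  interpret relative_adjunction_data X j r l A C E
    by unfold_locales fact+
  show ?thesis by (rule relative_adjunction_iff_left_lift)
qed

end
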